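(* Let $K$ be a field. Suppose that the following holds for every $n\ge 1$ and every proper monomial ideal $I\subset S=K[x_1,\ldots,x_n]$ with linear quotients: there exists $i\in\{1,\ldots,n\}$ such that (i) $\operatorname{depth}(S/(I,x_i))\ge\operatorname{depth}(S/I)$, and (ii) $\operatorname{sdepth}(S/(I,x_i))\le\operatorname{sdepth}(S/I)$. Then for every $n\ge 1$ and every proper monomial ideal $I\subset S=K[x_1,\ldots,x_n]$ with linear quotients, $\operatorname{sdepth}(S/I)\ge\operatorname{depth}(S/I)$.
   Context: For a monomial ideal $I\subset S=K[x_1,\ldots,x_n]$, $G(I)$ denotes its set of minimal monomial generators. $I$ has linear quotients if there is a linear order $u_1\leqslant u_2\leqslant\cdots\leqslant u_m$ on $G(I)$ such that for every $2\le j\le m$ the colon ideal $(u_1,\ldots,u_{j-1}):u_j$ is generated by a subset of the variables. $(I,x_i)$ denotes the ideal $I+(x_i)$. Stanley depth: for a $\mathbb Z^n$-graded $S$-module $M$, a Stanley decomposition of $M$ is a direct sum decomposition of $K$-vector spaces $\mathcal D: M=\bigoplus_{i=1}^r m_iK[Z_i]$, where each $m_i\in M$ is homogeneous (with respect to the $\mathbb Z^n$-grading), $Z_i\subset\{x_1,\ldots,x_n\}$, and $m_iK[Z_i]$ is a free $K[Z_i]$-module. Put $\operatorname{sdepth}(\mathcal D)=\min_{1\le i\le r}|Z_i|$ and $\operatorname{sdepth}(M)=\max\{\operatorname{sdepth}(\mathcal D) : \mathcal D \text{ a Stanley decomposition of } M\}$. $\operatorname{depth}$ is the usual depth with respect to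 the maximal ideal $(x_1,\ldots,x_n)$. *)

theory Defs
  imports "HOL-Algebra.QuotRing" "HOL-Algebra.Module"
    "HOL-Library.Poly_Mapping" "HOL-Library.Extended_Nat"
begin

section \<open>Polynomial rings\<close>

text \<open>
  Exponent vectors are finitely supported functions from variable indices to naturals, and
  polynomials are finitely supported functions from exponent vectors to coefficients.
  All polynomial rings live in this one type, which allows the number of variables to vary inside
  a statement: \<open>K[x\<^sub>i | i \<in> Z]\<close> is the subring of polynomials in which only variables from \<open>Z\<close> occur.
  The variables of \<open>K[x\<^sub>1, \<dots>, x\<^sub>n]\<close> are indexed by \<open>0, \<dots>, n - 1\<close>.
\<close>

type_synonym expo = "nat \<Rightarrow>\<^sub>0 nat"
type_synonym 'k mpoly = "expo \<Rightarrow>\<^sub>0 'k"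

definition poly_ring_on :: "nat set \<Rightarrow> 'k::field mpoly ring" where
  "poly_ring_on Z = \<lparr>carrier = {p. \<forall>m\<in>Poly_Mapping.keys p. Poly_Mapping.keys m \<subseteq> Z},
     mult = (*), one = 1, zero = 0, add = (+)\<rparr>"

abbreviation poly_ring :: "nat \<Rightarrow> 'k::field mpoly ring" where
  "poly_ring n \<equiv> poly_ring_on {..<n}"

definition monomial :: "expo \<Rightarrow> 'k::field mpoly" where
  "monomial m = Poly_Mapping.single m 1"

definition var :: "nat \<Rightarrow> 'k::field mpoly" where
  "var i = monomial (Poly_Mapping.single i 1)"

definition expos :: "nat \<Rightarrow> expo set" where
  "expos n = {m. Poly_Mapping.keys m \<subseteq> {..<n}}"

definition max_ideal :: "nat \<Rightarrow> 'k::field mpoly set" where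
  "max_ideal n = Idl\<^bsub>poly_ring n\<^esub> (var ` {..<n})"


section \<open>Monomial ideals and linear quotients\<close>

definition monomial_ideal :: "nat \<Rightarrow> 'k::field mpoly set \<Rightarrow> bool" where
  "monomial_ideal n I \<longleftrightarrow> (\<exists>A \<subseteq> expos n. I = Idl\<^bsub>poly_ring n\<^esub> (monomial ` A))"

definition expo_dvd :: "expo \<Rightarrow> expo \<Rightarrow> bool" where
  "expo_dvd u v \<longleftrightarrow> (\<forall>i. Poly_Mapping.lookup u i \<le> Poly_Mapping.lookup v i)"

text \<open>
  The exponent vectors of \<open>G(I)\<close>: the minimal monomial generators of a monomial ideal are the
  monomials in \<open>I\<close> that are minimal with respect to divisibility.
\<close>

definition min_gens :: "nat \<Rightarrow> 'k::field mpoly set \<Rightarrow> expo set" where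
  "min_gens n I = {u \<in> expos n. monomial u \<in> I \<and>
     (\<forall>v \<in> expos n. monomial v \<in> I \<longrightarrow> expo_dvd v u \<longrightarrow> v = u)}"

definition colon :: "nat \<Rightarrow> 'k::field mpoly set \<Rightarrow> 'k mpoly \<Rightarrow> 'k mpoly set" where
  "colon n I f = {p \<in> carrier (poly_ring n). p * f \<in> I}"

text \<open>
  The linear order on \<open>G(I)\<close> is given as a list without repetitions; \<open>take j us\<close> consists of the
  generators preceding \<open>us ! j\<close>. The zero ideal has linear quotients, by the empty list.
\<close>

definition linear_quotients :: "nat \<Rightarrow> 'k::field mpoly set \<Rightarrow> bool" where
  "linear_quotients n I \<longleftrightarrow>
     (\<exists>us. distinct us \<and> set us = min_gens n I \<and>
       (\<forall>j. 1 \<le> j \<and> j < length us \<longrightarrow>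
         (\<exists>V \<subseteq> {..<n}. colon n (Idl\<^bsub>poly_ring n\<^esub> (monomial ` set (take j us))) (monomial (us ! j))
            = (Idl\<^bsub>poly_ring n\<^esub> (var ` V) :: 'k mpoly set))))"

definition add_var :: "nat \<Rightarrow> 'k::field mpoly set \<Rightarrow> nat \<Rightarrow> 'k mpoly set" where
  "add_var n I i = I <+>\<^bsub>poly_ring n\<^esub> (PIdl\<^bsub>poly_ring n\<^esub> (var i))"


section \<open>Depth\<close>

text \<open>
  The \<open>R\<close>-module \<open>R/I\<close>: scalars act through the residue map \<open>R \<rightarrow> R/I\<close>.
\<close>

definition quot_module :: "('a, 'b) ring_scheme \<Rightarrow> 'a set \<Rightarrow> ('a, 'a set) module" where
  "quot_module R I = ring.extend (R Quot I)
     (module.fields (\<lambda>r X. (I +>\<^bsub>R\<^esub> r) \<otimes>\<^bsub>R Quot I\<^esub> X))"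

text \<open>The submodule \<open>(f\<^sub>1, \<dots>, f\<^sub>d)M\<close>; it is the zero submodule for the empty list.\<close>

definition list_smult :: "'a list \<Rightarrow> ('a, 'm) module \<Rightarrow> 'm set" where
  "list_smult fs M = {\<Oplus>\<^bsub>M\<^esub> j\<in>{..<length fs}. (fs ! j) \<odot>\<^bsub>M\<^esub> y j | y.
     y \<in> {..<length fs} \<rightarrow> carrier M}"

text \<open>
  Each \<open>f\<^sub>j\<close> is a nonzerodivisor on \<open>M/(f\<^sub>1, \<dots>, f\<^sub>j\<^sub>-\<^sub>1)M\<close>, and \<open>M \<noteq> (f\<^sub>1, \<dots>, f\<^sub>d)M\<close>.
\<close>

definition regular_sequence :: "('a, 'm) module \<Rightarrow> 'a list \<Rightarrow> bool" where
  "regular_sequence M fs \<longleftrightarrow>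
     (\<forall>j < length fs. \<forall>y \<in> carrier M.
        (fs ! j) \<odot>\<^bsub>M\<^esub> y \<in> list_smult (take j fs) M \<longrightarrow> y \<in> list_smult (take j fs) M) \<and>
     list_smult fs M \<noteq> carrier M"

text \<open>
  The largest length of a regular sequence in \<open>\<mm>\<close>; taken as a supremum in \<^typ>\<open>enat\<close>, it needs no
  boundedness of the lengths.
\<close>

definition depth :: "'a set \<Rightarrow> ('a, 'm) module \<Rightarrow> enat" where
  "depth \<mm> M = (SUP fs \<in> {fs. set fs \<subseteq> \<mm> \<and> regular_sequence M fs}. enat (length fs))"


section \<open>Stanley depth\<close>

text \<open>
  A \<open>\<int>\<^sup>n\<close>-grading on a module is given by its components. A degree is a function on all of \<^typ>\<open>nat\<close>;
  in \<open>n\<close> variables only those vanishing outside \<open>{..<n}\<close> have a nonzero component.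
\<close>

type_synonym 'm grading = "(nat \<Rightarrow> int) \<Rightarrow> 'm set"

definition poly_grading :: "nat \<Rightarrow> 'k::field mpoly grading" where
  "poly_grading n a = {p \<in> carrier (poly_ring n).
     \<forall>m\<in>Poly_Mapping.keys p. \<forall>i. int (Poly_Mapping.lookup m i) = a i}"

definition quot_grading :: "nat \<Rightarrow> 'k::field mpoly set \<Rightarrow> 'k mpoly set grading" where
  "quot_grading n I a = (\<lambda>p. I +>\<^bsub>poly_ring n\<^esub> p) ` poly_grading n a"

definition stanley_space :: "('k::field mpoly, 'm) module \<Rightarrow> 'm \<times> nat set \<Rightarrow> 'm set" where
  "stanley_space M = (\<lambda>(m, Z). {p \<odot>\<^bsub>M\<^esub> m | p. p \<in> carrier (poly_ring_on Z)})"

text \<open>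
  The third condition is freeness of \<open>mK[Z]\<close> over \<open>K[Z]\<close> (with basis \<open>m\<close>); the last one is
  directness of the sum: every element is uniquely a sum of elements of the Stanley spaces.
\<close>

definition stanley_decomposition ::
    "nat \<Rightarrow> ('k::field mpoly, 'm) module \<Rightarrow> 'm grading \<Rightarrow> ('m \<times> nat set) list \<Rightarrow> bool" where
  "stanley_decomposition n M gr D \<longleftrightarrow>
     (\<forall>(m, Z) \<in> set D. m \<in> carrier M \<and> (\<exists>a. m \<in> gr a) \<and> Z \<subseteq> {..<n} \<and>
        (\<forall>p \<in> carrier (poly_ring_on Z). p \<odot>\<^bsub>M\<^esub> m = \<zero>\<^bsub>M\<^esub> \<longrightarrow> p = 0)) \<and>
     (\<forall>v \<in> carrier M. \<exists>!w. w \<in> (\<Pi>\<^sub>E j\<in>{..<length D}. stanley_space M (D ! j)) \<and>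
        v = (\<Oplus>\<^bsub>M\<^esub> j\<in>{..<length D}. w j))"

definition sdepth_decomp :: "('m \<times> nat set) list \<Rightarrow> enat" where
  "sdepth_decomp D = (INF (m, Z) \<in> set D. enat (card Z))"

text \<open>
  For \<open>M \<noteq> 0\<close> all \<open>sdepth_decomp D\<close> are at most \<open>n\<close>, so the supremum is attained as soon as \<open>M\<close> has
  a Stanley decomposition.
\<close>

definition sdepth :: "nat \<Rightarrow> ('k::field mpoly, 'm) module \<Rightarrow> 'm grading \<Rightarrow> enat" where
  "sdepth n M gr = (SUP D \<in> {D. stanley_decomposition n M gr D}. sdepth_decomp D)"


section \<open>Invariants of \<open>S/I\<close>\<close>

definition depth_quot :: "nat \<Rightarrow> 'k::field mpoly set \<Rightarrow> enat" where
  "depth_quot n I = depth (max_ideal n) (quot_module (poly_ring n) I)"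

definition sdepth_quot :: "nat \<Rightarrow> 'k::field mpoly set \<Rightarrow> enat" where
  "sdepth_quot n I = sdepth n (quot_module (poly_ring n) I) (quot_grading n I)"

end

theory Submission
  imports Defs "HOL-Combinatorics.Transposition"
begin

text \<open>
  Induction on the number of variables. For \<open>I = 0\<close> the trivial decomposition gives \<open>sdepth S \<ge> n\<close>, and
  \<open>depth S \<le> n\<close>. For \<open>I \<noteq> 0\<close> take \<open>x\<^sub>i\<close> from the hypothesis: \<open>S/(I, x\<^sub>i) \<cong> S'/I'\<close>, where \<open>S'\<close> lacks the variable
  \<open>x\<^sub>i\<close> and \<open>I'\<close> is generated by the generators of \<open>I\<close> not divisible by \<open>x\<^sub>i\<close>; these still have linear
  quotients, in the same order, because a monomial without \<open>x\<^sub>i\<close> is only divisible by such generators.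
  Hence \<open>sdepth S/I \<ge> sdepth S'/I' \<ge> depth S'/I' \<ge> depth S/I\<close>. As variables are numbered consecutively,
  \<open>S'\<close> is identified with \<open>K[x\<^sub>0, \<dots>, x\<^sub>n\<^sub>-\<^sub>1]\<close> by the transposition of \<open>i\<close> and the last index.
\<close>

text \<open>The zero ideal is set apart because the induction step cannot reach it:
  \<open>S/(x\<^sub>i)\<close> is a polynomial ring in n - 1 variables, so adding a variable to 0
  lowers the depth. The bound depth S \<le> n needed there is the laborious part: depth is a
  supremum over regular sequences, so every such sequence has to be bounded in length. Linear
  algebra over K takes the place of dimension theory, by comparing the number of power products with
  the number of available monomials.

  The two invariants cross between S and S' in opposite directions. Regular sequences are pushed
  forward along the surjection from S to S' that sets \<open>x\<^sub>i\<close> to 0; Stanley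
  decompositions are carried from S'/I' back to \<open>S/(I, x\<^sub>i)\<close>. Membership in a
  monomial ideal depends on exponent vectors only, so the passage of ideals, minimal generators and
  colon ideals to S' becomes a matter of divisibility of exponent vectors.\<close>

section \<open>Polynomial rings\<close>

abbreviation keys :: "('a \<Rightarrow>\<^sub>0 'b::zero) \<Rightarrow> 'a set" where "keys \<equiv> Poly_Mapping.keys"
abbreviation lookup :: "('a \<Rightarrow>\<^sub>0 'b::zero) \<Rightarrow> 'a \<Rightarrow> 'b" where "lookup \<equiv> Poly_Mapping.lookup"

lemma poly_ring_on_simps [simp]:
  "p \<in> carrier (poly_ring_on Z) \<longleftrightarrow> (\<forall>m\<in>keys p. keys m \<subseteq> Z)"
  "mult (poly_ring_on Z) = (*)" "one (poly_ring_on Z) = 1"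
  "zero (poly_ring_on Z) = 0" "add (poly_ring_on Z) = (+)"
  by (auto simp: poly_ring_on_def)

lemma keys_add_expo: "keys (a + b :: expo) = keys a \<union> keys b"
  by (auto simp: in_keys_iff lookup_add)

lemma cring_poly_ring_on: "cring (poly_ring_on Z :: 'k::field mpoly ring)"
proof (rule cringI)
  show "abelian_group (poly_ring_on Z :: 'k mpoly ring)"
  proof (rule abelian_groupI)
    fix x y :: "'k mpoly"
    assume "x \<in> carrier (poly_ring_on Z)" "y \<in> carrier (poly_ring_on Z)"
    then show "x \<oplus>\<^bsub>poly_ring_on Z\<^esub> y \<in> carrier (poly_ring_on Z)"
      using keys_add[of x y] by auto
  next
    fix x :: "'k mpoly"
    assume "x \<in> carrier (poly_ring_on Z)"
    then show "\<exists>y\<in>carrier (poly_ring_on Z). y \<oplus>\<^bsub>poly_ring_on Z\<^esub> x = \<zero>\<^bsub>poly_ring_on Z\<^esub>"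
      by (intro bexI[of _ "- x"]) (auto simp: in_keys_iff)
  qed (auto simp: add.assoc add.commute)
  show "Group.comm_monoid (poly_ring_on Z :: 'k mpoly ring)"
  proof (rule comm_monoidI)
    fix x y :: "'k mpoly"
    assume "x \<in> carrier (poly_ring_on Z)" "y \<in> carrier (poly_ring_on Z)"
    then show "x \<otimes>\<^bsub>poly_ring_on Z\<^esub> y \<in> carrier (poly_ring_on Z)"
      by (auto dest!: subsetD[OF keys_mult] simp: keys_add_expo; blast)
  qed (auto simp: mult.assoc mult.commute)
qed (auto simp: distrib_right)

lemma ring_poly_ring_on: "Ring.ring (poly_ring_on Z :: 'k::field mpoly ring)"
  using cring_poly_ring_on cring.axioms(1) by blast

lemma a_inv_poly_ring_on:
  fixes p :: "'k::field mpoly"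
  assumes "p \<in> carrier (poly_ring_on Z)"
  shows "\<ominus>\<^bsub>poly_ring_on Z\<^esub> p = - p"
proof -
  interpret cring "poly_ring_on Z :: 'k mpoly ring" by (rule cring_poly_ring_on)
  have "- p \<in> carrier (poly_ring_on Z)" using assms by (auto simp: in_keys_iff)
  then show ?thesis using assms minus_equality[of "- p" p] by simp
qed

lemma poly_ring_closed:
  fixes p q :: "'k::field mpoly"
  assumes "p \<in> carrier (poly_ring_on Z)" "q \<in> carrier (poly_ring_on Z)"
  shows "p + q \<in> carrier (poly_ring_on Z)" "p * q \<in> carrier (poly_ring_on Z)"
    "- p \<in> carrier (poly_ring_on Z)" "p - q \<in> carrier (poly_ring_on Z)"
proof -
  interpret cring "poly_ring_on Z :: 'k mpoly ring" by (rule cring_poly_ring_on)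
  show "p + q \<in> carrier (poly_ring_on Z)" "p * q \<in> carrier (poly_ring_on Z)"
    using a_closed[OF assms] m_closed[OF assms] by (simp_all only: poly_ring_on_simps(2,5))
  have m: "- p \<in> carrier (poly_ring_on Z)" if "p \<in> carrier (poly_ring_on Z)" for p :: "'k mpoly"
    using that by (auto simp: in_keys_iff)
  show "- p \<in> carrier (poly_ring_on Z)" by (rule m[OF assms(1)])
  show "p - q \<in> carrier (poly_ring_on Z)"
    using a_closed[OF assms(1) m[OF assms(2)]]
    by (simp only: poly_ring_on_simps(2,5) diff_conv_add_uminus)
qed

lemma ideal_closed:
  fixes J :: "'k::field mpoly set"
  assumes "ideal J (poly_ring_on Z)"
  shows "0 \<in> J" "p \<in> J \<Longrightarrow> p \<in> carrier (poly_ring_on Z)"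
    "p \<in> J \<Longrightarrow> q \<in> J \<Longrightarrow> p + q \<in> J" "p \<in> J \<Longrightarrow> - p \<in> J" "p \<in> J \<Longrightarrow> q \<in> J \<Longrightarrow> p - q \<in> J"
    "p \<in> J \<Longrightarrow> q \<in> carrier (poly_ring_on Z) \<Longrightarrow> p * q \<in> J"
    "p \<in> J \<Longrightarrow> q \<in> carrier (poly_ring_on Z) \<Longrightarrow> q * p \<in> J"
proof -
  interpret ideal J "poly_ring_on Z" by fact
  show "0 \<in> J" using additive_subgroup.zero_closed[OF additive_subgroup_axioms] by simp
  show c: "p \<in> carrier (poly_ring_on Z)" if "p \<in> J" for p by (rule a_Hcarr[OF that])
  show "p + q \<in> J" if "p \<in> J" "q \<in> J" for p q
    using additive_subgroup.a_closed[OF additive_subgroup_axioms that] by simp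
  show m: "- p \<in> J" if "p \<in> J" for p
    using I_l_closed[OF that, of "- 1"] by (simp add: in_keys_iff lookup_one when_def)
  show "p - q \<in> J" if "p \<in> J" "q \<in> J" for p q
    using additive_subgroup.a_closed[OF additive_subgroup_axioms that(1) m[OF that(2)]] by simp
  show "p * q \<in> J" if "p \<in> J" "q \<in> carrier (poly_ring_on Z)"
    using I_r_closed[OF that] by simp
  show "q * p \<in> J" if "p \<in> J" "q \<in> carrier (poly_ring_on Z)"
    using I_l_closed[OF that] by simp
qed

text \<open>Negatives are covered by the last assumption, with q = -1.\<close>

lemma idealI_poly_ring_on:
  fixes J :: "'k::field mpoly set"
  assumes "J \<subseteq> carrier (poly_ring_on Z)" "0 \<in> J" "\<And>p q. p \<in> J \<Longrightarrow> q \<in> J \<Longrightarrow> p + q \<in> J"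
    "\<And>p q. p \<in> J \<Longrightarrow> q \<in> carrier (poly_ring_on Z) \<Longrightarrow> q * p \<in> J"
  shows "ideal J (poly_ring_on Z)"
proof (rule idealI[OF ring_poly_ring_on])
  interpret cring "poly_ring_on Z :: 'k mpoly ring" by (rule cring_poly_ring_on)
  have m: "\<ominus>\<^bsub>poly_ring_on Z\<^esub> a \<in> J" if "a \<in> J" for a
  proof -
    have "(- 1) * a \<in> J" by (rule assms(4)[OF that]) (auto simp: in_keys_iff)
    then show ?thesis using a_inv_poly_ring_on[of a Z] assms(1) that by auto
  qed
  show "subgroup J (add_monoid (poly_ring_on Z))"
    by (rule add.subgroupI) (use assms m in \<open>auto simp: subset_iff\<close>)
  show "x \<otimes>\<^bsub>poly_ring_on Z\<^esub> a \<in> J" "a \<otimes>\<^bsub>poly_ring_on Z\<^esub> x \<in> J"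
    if "a \<in> J" "x \<in> carrier (poly_ring_on Z)" for a x
    using assms(4)[OF that] by (simp_all add: mult.commute)
qed


section \<open>Monomial ideals\<close>

lemma poly_mapping_sum_single: "(p :: 'a \<Rightarrow>\<^sub>0 'b::comm_monoid_add) = (\<Sum>m\<in>keys p. Poly_Mapping.single m (lookup p m))"
  by (rule poly_mapping_eqI) (auto simp: lookup_sum lookup_single when_def in_keys_iff)

lemma poly_mapping_sum_closed:
  fixes p :: "'a \<Rightarrow>\<^sub>0 'b::comm_monoid_add"
  assumes "0 \<in> J" "\<And>p q. p \<in> J \<Longrightarrow> q \<in> J \<Longrightarrow> p + q \<in> J"
    "\<And>m. m \<in> keys p \<Longrightarrow> Poly_Mapping.single m (lookup p m) \<in> J"
  shows "p \<in> J"
proof -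
  have "(\<Sum>m\<in>A. Poly_Mapping.single m (lookup p m)) \<in> J" if "finite A" "A \<subseteq> keys p" for A
    using that by (induction A rule: finite_induct) (simp_all add: assms)
  from this[of "keys p"] show ?thesis using poly_mapping_sum_single[of p] by simp
qed

text \<open>Membership is read off the support, so questions about monomial ideals become questions
  about exponent vectors. \<open>Idl_monomials\<close> identifies it with the generated ideal when A
  lies in \<open>expos n\<close>.\<close>

definition mono_ideal :: "nat \<Rightarrow> expo set \<Rightarrow> 'k::field mpoly set" where
  "mono_ideal n A = {p. \<forall>m\<in>keys p. m \<in> expos n \<and> (\<exists>a\<in>A. expo_dvd a m)}"

lemma expos_add: "a + b \<in> expos n \<longleftrightarrow> a \<in> expos n \<and> b \<in> expos n"
  by (auto simp: expos_def keys_add_expo)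

lemma expo_dvd_add: "expo_dvd a m \<Longrightarrow> expo_dvd a (k + m)"
  by (auto simp: expo_dvd_def lookup_add trans_le_add2)

lemma expo_dvdE: "expo_dvd a m \<Longrightarrow> \<exists>k. m = k + a"
  by (rule exI[of _ "m - a"])
     (auto simp: expo_dvd_def lookup_add lookup_minus intro!: poly_mapping_eqI)

lemma expo_dvd_refl [simp]: "expo_dvd a a"
  by (simp add: expo_dvd_def)

lemma expo_dvd_single: "expo_dvd (Poly_Mapping.single k (Suc 0)) m \<longleftrightarrow> 0 < lookup m k"
  by (auto simp: expo_dvd_def lookup_single when_def)

lemma single_in_expos: "k < n \<Longrightarrow> Poly_Mapping.single k c \<in> expos n"
  by (auto simp: expos_def)

lemma keys_monomial [simp]: "keys (monomial m :: 'k::field mpoly) = {m}"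
  by (simp add: monomial_def)

lemma carrier_poly_ring: "p \<in> carrier (poly_ring n) \<longleftrightarrow> keys p \<subseteq> expos n"
  by (auto simp: expos_def)

lemma ideal_mono_ideal: "ideal (mono_ideal n A :: 'k::field mpoly set) (poly_ring n)"
proof (rule idealI_poly_ring_on)
  fix p q :: "'k mpoly"
  assume p: "p \<in> mono_ideal n A"
  { assume "q \<in> mono_ideal n A"
    then show "p + q \<in> mono_ideal n A"
      using p keys_add[of p q] by (auto simp: mono_ideal_def) }
  { assume "q \<in> carrier (poly_ring n)"
    then show "q * p \<in> mono_ideal n A"
      using p unfolding carrier_poly_ring
      by (auto dest!: subsetD[OF keys_mult] simp: mono_ideal_def expos_add; blast intro: expo_dvd_add) }
qed (auto simp: mono_ideal_def expos_def)

lemma Idl_monomials: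
  assumes "A \<subseteq> expos n"
  shows "Idl\<^bsub>poly_ring n\<^esub> (monomial ` A) = (mono_ideal n A :: 'k::field mpoly set)"
proof
  interpret cring "poly_ring n :: 'k mpoly ring" by (rule cring_poly_ring_on)
  show "Idl\<^bsub>poly_ring n\<^esub> (monomial ` A) \<subseteq> (mono_ideal n A :: 'k mpoly set)"
    by (rule genideal_minimal[OF ideal_mono_ideal]) (use assms in \<open>auto simp: mono_ideal_def intro: bexI[where P = "\<lambda>a. expo_dvd a m" for m, OF expo_dvd_refl]\<close>)
  have sub: "monomial ` A \<subseteq> carrier (poly_ring n :: 'k mpoly ring)"
    using assms by (auto simp: expos_def)
  note id = genideal_ideal[OF sub]
  show "mono_ideal n A \<subseteq> (Idl\<^bsub>poly_ring n\<^esub> (monomial ` A) :: 'k mpoly set)"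
  proof
    fix p :: "'k mpoly"
    assume p: "p \<in> mono_ideal n A"
    show "p \<in> Idl\<^bsub>poly_ring n\<^esub> (monomial ` A)"
    proof (rule poly_mapping_sum_closed)
      fix m assume "m \<in> keys p"
      then obtain a k where a: "a \<in> A" "m = k + a" "m \<in> expos n"
        using p expo_dvdE by (force simp: mono_ideal_def)
      \<comment> \<open>The term of p at m = k + a is a term at k times the generator
        \<open>monomial a\<close>, and p is the sum of its terms.\<close>
      then have "Poly_Mapping.single k (lookup p m) * monomial a \<in> Idl\<^bsub>poly_ring n\<^esub> (monomial ` A)"
        using genideal_self[OF sub] expos_add[of k a n]
        by (intro ideal_closed(7)[OF id]) (auto simp: expos_def split: if_splits)
      then show "Poly_Mapping.single m (lookup p m) \<in> Idl\<^bsub>poly_ring n\<^esub> (monomial ` A)"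
        using a by (simp add: monomial_def mult_single)
    qed (use ideal_closed[OF id] in auto)
  qed
qed

lemma Idl_vars:
  assumes "V \<subseteq> {..<n}"
  shows "Idl\<^bsub>poly_ring n\<^esub> (var ` V) = (mono_ideal n ((\<lambda>k. Poly_Mapping.single k 1) ` V) :: 'k::field mpoly set)"
proof -
  have "(var ` V :: 'k mpoly set) = monomial ` ((\<lambda>k. Poly_Mapping.single k 1) ` V)"
    by (auto simp: var_def image_image)
  moreover have "(\<lambda>k. Poly_Mapping.single k 1) ` V \<subseteq> expos n"
    using assms single_in_expos by blast
  ultimately show ?thesis using Idl_monomials[of "(\<lambda>k. Poly_Mapping.single k 1) ` V" n, where 'k='k] by simp
qed

lemma max_ideal_eq: "max_ideal n = {p :: 'k::field mpoly. keys p \<subseteq> expos n \<and> 0 \<notin> keys p}"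
proof -
  have "(\<exists>k<n. 0 < lookup m k) \<longleftrightarrow> m \<noteq> 0" if "m \<in> expos n" for m
  proof -
    have "(\<exists>k<n. 0 < lookup m k) \<longleftrightarrow> (\<exists>k. k \<in> keys m)"
      using that unfolding expos_def by (auto simp: in_keys_iff subset_iff)
    also have "\<dots> \<longleftrightarrow> keys m \<noteq> {}" by blast
    finally have "(\<exists>k<n. 0 < lookup m k) \<longleftrightarrow> keys m \<noteq> {}" .
    then show ?thesis by simp
  qed
  then show ?thesis
    unfolding max_ideal_def Idl_vars[OF order_refl] mono_ideal_def
    by (auto simp: expo_dvd_single; blast)
qed

text \<open>From here on membership in the carrier stays folded and is handled by closure rules;
  automatic unfolding would turn each such side condition into one about supports.\<close>

declare poly_ring_on_simps(1) [simp del]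

lemma poly_ring_consts [simp]:
  "0 \<in> carrier (poly_ring_on Z)" "1 \<in> carrier (poly_ring_on Z)"
  by (simp_all add: poly_ring_on_simps(1))

text \<open>Brings \<open>(I, x\<^sub>i)\<close> into the form on which the elimination of
  \<open>x\<^sub>i\<close> works. The sum of two ideals is generated by their union, hence by both
  sets of generators together.\<close>

lemma mono_ideal_insert_var:
  assumes "A \<subseteq> expos n" "i < n"
  shows "add_var n (mono_ideal n A) i = (mono_ideal n (insert (Poly_Mapping.single i 1) A) :: 'k::field mpoly set)"
proof -
  interpret cring "poly_ring n :: 'k mpoly ring" by (rule cring_poly_ring_on)
  let ?x = "Poly_Mapping.single i 1 :: expo"
  have x: "(var i :: 'k mpoly) \<in> carrier (poly_ring n)" using single_in_expos[OF assms(2)] unfolding carrier_poly_ring by (simp add: var_def)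
  have "PIdl\<^bsub>poly_ring n\<^esub> (var i) = Idl\<^bsub>poly_ring n\<^esub> (monomial ` {?x} :: 'k mpoly set)"
    using cgenideal_eq_genideal[OF x] by (simp add: var_def)
  then have P: "PIdl\<^bsub>poly_ring n\<^esub> (var i) = (mono_ideal n {?x} :: 'k mpoly set)"
    using Idl_monomials[of "{?x}" n] single_in_expos[OF assms(2)] by simp
  have "add_var n (mono_ideal n A) i = Idl\<^bsub>poly_ring n\<^esub> (mono_ideal n A \<union> mono_ideal n {?x} :: 'k mpoly set)"
    unfolding add_var_def P by (rule union_genideal[symmetric, OF ideal_mono_ideal ideal_mono_ideal])
  also have "\<dots> = mono_ideal n (insert ?x A)"
  proof
    show "Idl\<^bsub>poly_ring n\<^esub> (mono_ideal n A \<union> mono_ideal n {?x} :: 'k mpoly set) \<subseteq> mono_ideal n (insert ?x A)"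
      by (rule genideal_minimal[OF ideal_mono_ideal]) (auto simp: mono_ideal_def)
    have sub: "mono_ideal n A \<union> mono_ideal n {?x} \<subseteq> carrier (poly_ring n :: 'k mpoly ring)"
      using ideal_closed(2)[OF ideal_mono_ideal] by blast
    have "mono_ideal n (insert ?x A) = (Idl\<^bsub>poly_ring n\<^esub> (monomial ` insert ?x A) :: 'k mpoly set)"
      using Idl_monomials[of "insert ?x A" n, where 'k='k] assms(1) single_in_expos[OF assms(2), of 1] by simp
    also have "\<dots> \<subseteq> Idl\<^bsub>poly_ring n\<^esub> (mono_ideal n A \<union> mono_ideal n {?x} :: 'k mpoly set)"
    proof (rule genideal_minimal[OF genideal_ideal[OF sub]])
      show "monomial ` insert ?x A \<subseteq> Idl\<^bsub>poly_ring n\<^esub> (mono_ideal n A \<union> mono_ideal n {?x} :: 'k mpoly set)"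
      proof (rule order_trans[OF _ genideal_self[OF sub]], rule image_subsetI)
        fix a assume "a \<in> insert ?x A"
        then have "a \<in> expos n" using assms single_in_expos by blast
        then show "monomial a \<in> mono_ideal n A \<union> (mono_ideal n {?x} :: 'k mpoly set)"
          using \<open>a \<in> insert ?x A\<close> expo_dvd_refl[of a] by (auto simp del: expo_dvd_refl simp: mono_ideal_def)
      qed
    qed
    finally show "mono_ideal n (insert ?x A) \<subseteq> (Idl\<^bsub>poly_ring n\<^esub> (mono_ideal n A \<union> mono_ideal n {?x}) :: 'k mpoly set)" .
  qed
  finally show ?thesis .
qed


section \<open>Quotient modules\<close>

lemma quot_module_simps:
  "carrier (quot_module R J) = a_rcosets\<^bsub>R\<^esub> J" "zero (quot_module R J) = J"
  "add (quot_module R J) = set_add R"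
  "smult (quot_module R J) r X = rcoset_mult R J (J +>\<^bsub>R\<^esub> r) X"
  by (simp_all add: quot_module_def ring.defs module.defs FactRing_def)

abbreviation coset :: "nat set \<Rightarrow> 'k::field mpoly set \<Rightarrow> 'k mpoly \<Rightarrow> 'k mpoly set" where
  "coset Z J p \<equiv> J +>\<^bsub>poly_ring_on Z\<^esub> p"

lemma poly_ring_on_sum:
  "(\<And>a. a \<in> A \<Longrightarrow> y a \<in> carrier (poly_ring_on Z)) \<Longrightarrow> sum y A \<in> carrier (poly_ring_on Z :: 'k::field mpoly ring)"
proof (induction A rule: infinite_finite_induct)
  case (insert a A)
  then have "y a \<in> carrier (poly_ring_on Z)" "sum y A \<in> carrier (poly_ring_on Z)" by blast+
  then show ?case using insert.hyps poly_ring_closed(1)[of "y a" Z "sum y A"] by simp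
qed auto

context
  fixes Z :: "nat set" and J :: "'k::field mpoly set"
  assumes J: "ideal J (poly_ring_on Z)"
begin

interpretation ideal J "poly_ring_on Z" by (rule J)

lemma abelian_group_quot_module: "abelian_group (quot_module (poly_ring_on Z) J)"
proof -
  interpret Q: Ring.ring "poly_ring_on Z Quot J" by (rule quotient_is_ring)
  have [simp]: "carrier (quot_module (poly_ring_on Z) J) = carrier (poly_ring_on Z Quot J)"
    "zero (quot_module (poly_ring_on Z) J) = zero (poly_ring_on Z Quot J)"
    "add (quot_module (poly_ring_on Z) J) = add (poly_ring_on Z Quot J)"
    by (simp_all add: quot_module_simps FactRing_def)
  show ?thesis
  proof (rule abelian_groupI)
    fix X assume "X \<in> carrier (quot_module (poly_ring_on Z) J)"
    then show "\<exists>Y\<in>carrier (quot_module (poly_ring_on Z) J).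
        Y \<oplus>\<^bsub>quot_module (poly_ring_on Z) J\<^esub> X = \<zero>\<^bsub>quot_module (poly_ring_on Z) J\<^esub>"
      using Q.l_neg[of X] Q.a_inv_closed[of X] by auto
  qed (simp_all add: Q.a_assoc, simp add: Q.a_comm)
qed

lemma mem_coset_iff: "x \<in> coset Z J p \<longleftrightarrow> x - p \<in> J"
  by (auto simp: a_r_coset_def' intro: bexI[of _ "x - p"])

lemma coset_eq_iff: "coset Z J p = coset Z J q \<longleftrightarrow> p - q \<in> J"
proof
  assume "coset Z J p = coset Z J q"
  then show "p - q \<in> J" using mem_coset_iff[of p p] mem_coset_iff[of p q] ideal_closed(1)[OF J] by simp
next
  assume *: "p - q \<in> J"
  show "coset Z J p = coset Z J q"
  proof (rule Set.set_eqI)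
    fix x
    show "x \<in> coset Z J p \<longleftrightarrow> x \<in> coset Z J q"
      using ideal_closed(3)[OF J _ *, of "x - p"] ideal_closed(5)[OF J _ *, of "x - q"]
      by (auto simp: mem_coset_iff)
  qed
qed

lemma carrier_quot_module:
  "carrier (quot_module (poly_ring_on Z) J) = coset Z J ` carrier (poly_ring_on Z)"
  by (auto simp: quot_module_simps A_RCOSETS_def')

lemma zero_quot_module: "zero (quot_module (poly_ring_on Z) J) = coset Z J 0"
  by (auto simp: quot_module_simps mem_coset_iff)

lemma add_quot_module:
  "p \<in> carrier (poly_ring_on Z) \<Longrightarrow> q \<in> carrier (poly_ring_on Z) \<Longrightarrow>
    coset Z J p \<oplus>\<^bsub>quot_module (poly_ring_on Z) J\<^esub> coset Z J q = coset Z J (p + q)"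
  using a_rcos_sum[of p q] by (simp add: quot_module_simps)

lemma smult_quot_module:
  "p \<in> carrier (poly_ring_on Z) \<Longrightarrow> q \<in> carrier (poly_ring_on Z) \<Longrightarrow>
    p \<odot>\<^bsub>quot_module (poly_ring_on Z) J\<^esub> coset Z J q = coset Z J (p * q)"
  using rcoset_mult_add[of p q] by (simp add: quot_module_simps)

lemma finsum_quot_module:
  assumes "finite A" "\<And>a. a \<in> A \<Longrightarrow> y a \<in> carrier (poly_ring_on Z)"
  shows "finsum (quot_module (poly_ring_on Z) J) (\<lambda>a. coset Z J (y a)) A = coset Z J (sum y A)"
proof -
  interpret M: abelian_group "quot_module (poly_ring_on Z) J" by (rule abelian_group_quot_module)
  show ?thesis using assms
  proof (induction A rule: finite_induct)
    case empty
    then show ?case by (simp add: zero_quot_module)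
  next
    case (insert a A)
    then have y: "y a \<in> carrier (poly_ring_on Z)" "sum y A \<in> carrier (poly_ring_on Z)"
      "\<And>b. b \<in> A \<Longrightarrow> coset Z J (y b) \<in> carrier (quot_module (poly_ring_on Z) J)"
      "coset Z J (y a) \<in> carrier (quot_module (poly_ring_on Z) J)"
      using poly_ring_on_sum[of A y] by (auto simp: carrier_quot_module)
    then have "finsum (quot_module (poly_ring_on Z) J) (\<lambda>a. coset Z J (y a)) (insert a A)
      = coset Z J (y a) \<oplus>\<^bsub>quot_module (poly_ring_on Z) J\<^esub> finsum (quot_module (poly_ring_on Z) J) (\<lambda>a. coset Z J (y a)) A"
      using insert.hyps by (intro M.finsum_insert) auto
    also have "\<dots> = coset Z J (sum y (insert a A))"
      using insert y(1,2) by (simp add: add_quot_module)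
    finally show ?case .
  qed
qed

end


section \<open>Regular sequences\<close>

text \<open>The ideal J + (f), to be divided out once f has been used.\<close>

definition extend_ideal :: "nat set \<Rightarrow> 'k::field mpoly set \<Rightarrow> 'k mpoly \<Rightarrow> 'k mpoly set" where
  "extend_ideal Z J f = {a + f * r | a r. a \<in> J \<and> r \<in> carrier (poly_ring_on Z)}"

text \<open>Regularity on S/J told entirely inside S: the recursion enlarges J instead of passing to
  further quotient modules. This allows induction over the sequence with J arbitrary.\<close>

fun regular :: "nat set \<Rightarrow> 'k::field mpoly set \<Rightarrow> 'k mpoly list \<Rightarrow> bool" where
  "regular Z J [] \<longleftrightarrow> J \<noteq> carrier (poly_ring_on Z)"
| "regular Z J (f # fs) \<longleftrightarrow> (\<forall>y\<in>carrier (poly_ring_on Z). f * y \<in> J \<longrightarrow> y \<in> J) \<and>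
     regular Z (extend_ideal Z J f) fs"

lemma ideal_extend_ideal:
  fixes J :: "'k::field mpoly set"
  assumes J: "ideal J (poly_ring_on Z)" and f: "f \<in> carrier (poly_ring_on Z)"
  shows "ideal (extend_ideal Z J f) (poly_ring_on Z)"
proof (rule idealI_poly_ring_on)
  show "extend_ideal Z J f \<subseteq> carrier (poly_ring_on Z)"
    unfolding extend_ideal_def
    using poly_ring_closed(1)[OF ideal_closed(2)[OF J] poly_ring_closed(2)[OF f]] by blast
  show "0 \<in> extend_ideal Z J f"
    unfolding extend_ideal_def using ideal_closed(1)[OF J] by (auto intro!: exI[of _ 0])
  fix p q :: "'k mpoly" assume "p \<in> extend_ideal Z J f"
  then obtain a r where p: "p = a + f * r" "a \<in> J" "r \<in> carrier (poly_ring_on Z)"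
    by (auto simp: extend_ideal_def)
  { assume "q \<in> extend_ideal Z J f"
    then obtain b s where q: "q = b + f * s" "b \<in> J" "s \<in> carrier (poly_ring_on Z)"
      by (auto simp: extend_ideal_def)
    have "p + q = (a + b) + f * (r + s)" by (simp add: p q algebra_simps)
    then show "p + q \<in> extend_ideal Z J f"
      unfolding extend_ideal_def using ideal_closed(3)[OF J p(2) q(2)] poly_ring_closed(1)[OF p(3) q(3)]
      by blast }
  { assume q: "q \<in> carrier (poly_ring_on Z)"
    have "q * p = q * a + f * (q * r)" by (simp add: p algebra_simps)
    then show "q * p \<in> extend_ideal Z J f"
      unfolding extend_ideal_def using ideal_closed(7)[OF J p(2) q] poly_ring_closed(2)[OF q p(3)]
      by blast }
qed

text \<open>The preimage in S of the submodule of S/J generated by the multiples of the sequence; it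
  links \<open>list_smult\<close> with the recursion in \<open>regular\<close>.\<close>

definition sum_ideal :: "nat set \<Rightarrow> 'k::field mpoly set \<Rightarrow> 'k mpoly list \<Rightarrow> 'k mpoly set" where
  "sum_ideal Z J fs = {a + (\<Sum>j<length fs. fs ! j * y j) | a y.
     a \<in> J \<and> (\<forall>j<length fs. y j \<in> carrier (poly_ring_on Z))}"

lemma sum_ideal_Nil: "sum_ideal Z J [] = J"
  by (auto simp: sum_ideal_def)

lemma sum_ideal_Cons: "sum_ideal Z J (f # fs) = sum_ideal Z (extend_ideal Z J f) fs"
proof
  show "sum_ideal Z J (f # fs) \<subseteq> sum_ideal Z (extend_ideal Z J f) fs"
  proof
    fix p assume "p \<in> sum_ideal Z J (f # fs)"
    then obtain a y where p: "p = a + (\<Sum>j<Suc (length fs). (f # fs) ! j * y j)" "a \<in> J"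
      "\<forall>j<Suc (length fs). y j \<in> carrier (poly_ring_on Z)"
      by (auto simp: sum_ideal_def simp del: sum.lessThan_Suc)
    have "p = (a + f * y 0) + (\<Sum>j<length fs. fs ! j * y (Suc j))"
      unfolding p(1) sum.lessThan_Suc_shift by (simp add: add.assoc)
    moreover have "a + f * y 0 \<in> extend_ideal Z J f"
      using p(2,3) unfolding extend_ideal_def by blast
    ultimately show "p \<in> sum_ideal Z (extend_ideal Z J f) fs"
      unfolding sum_ideal_def using p(3) by (intro CollectI exI[of _ "a + f * y 0"] exI[of _ "y \<circ> Suc"]) auto
  qed
  show "sum_ideal Z (extend_ideal Z J f) fs \<subseteq> sum_ideal Z J (f # fs)"
  proof
    fix p assume "p \<in> sum_ideal Z (extend_ideal Z J f) fs"
    then obtain a r y where p: "p = (a + f * r) + (\<Sum>j<length fs. fs ! j * y j)" "a \<in> J"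
      "\<forall>j<length fs. y j \<in> carrier (poly_ring_on Z)" "r \<in> carrier (poly_ring_on Z)"
      by (auto simp: sum_ideal_def extend_ideal_def)
    let ?y = "\<lambda>j. case j of 0 \<Rightarrow> r | Suc j \<Rightarrow> y j"
    have "p = a + (\<Sum>j<length (f # fs). (f # fs) ! j * ?y j)"
      unfolding p(1) length_Cons sum.lessThan_Suc_shift by (simp add: add.assoc)
    moreover have "\<forall>j<length (f # fs). ?y j \<in> carrier (poly_ring_on Z)"
      using p(3,4) by (auto split: nat.split)
    ultimately show "p \<in> sum_ideal Z J (f # fs)"
      unfolding sum_ideal_def using p(2) by blast
  qed
qed

lemma sum_ideal_ideal:
  fixes J :: "'k::field mpoly set"
  assumes "ideal J (poly_ring_on Z)" "set fs \<subseteq> carrier (poly_ring_on Z)"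
  shows "ideal (sum_ideal Z J fs) (poly_ring_on Z)"
  using assms
  by (induction fs arbitrary: J)
     (simp_all add: sum_ideal_Nil sum_ideal_Cons ideal_extend_ideal)

lemma sum_ideal_mono: "ideal J (poly_ring_on Z) \<Longrightarrow> J \<subseteq> sum_ideal Z J fs"
proof
  fix x assume "x \<in> J"
  then show "x \<in> sum_ideal Z J fs"
    unfolding sum_ideal_def by (intro CollectI exI[of _ x] exI[of _ "\<lambda>_. 0"]) simp
qed

text \<open>Peeling off the first element shifts the index: the condition at 0 is the first clause
  of \<open>regular\<close>, and the conditions at j + 1 are those at j for the tail over
  \<open>extend_ideal Z J f\<close>.\<close>

lemma regular_iff_sum_ideal:
  "regular Z J fs \<longleftrightarrow>
     (\<forall>j<length fs. \<forall>y\<in>carrier (poly_ring_on Z).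
        fs ! j * y \<in> sum_ideal Z J (take j fs) \<longrightarrow> y \<in> sum_ideal Z J (take j fs)) \<and>
     sum_ideal Z J fs \<noteq> carrier (poly_ring_on Z)"
proof (induction fs arbitrary: J)
  case (Cons f fs)
  show ?case
    unfolding regular.simps Cons.IH length_Cons All_less_Suc2
    by (simp add: sum_ideal_Cons sum_ideal_Nil)
qed (simp add: sum_ideal_Nil)

text \<open>Choosing representatives moves the sums into S. The summand from J in
  \<open>sum_ideal\<close> becomes zero in S/J.\<close>

lemma list_smult_quot_module:
  fixes J :: "'k::field mpoly set"
  assumes J: "ideal J (poly_ring_on Z)" and fs: "set fs \<subseteq> carrier (poly_ring_on Z)"
  shows "list_smult fs (quot_module (poly_ring_on Z) J) = coset Z J ` sum_ideal Z J fs" (is "?l = ?r")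
proof -
  have sum: "(\<Oplus>\<^bsub>quot_module (poly_ring_on Z) J\<^esub> j\<in>{..<length fs}.
      (fs ! j) \<odot>\<^bsub>quot_module (poly_ring_on Z) J\<^esub> coset Z J (y j)) = coset Z J (\<Sum>j<length fs. fs ! j * y j)"
    if y: "\<forall>j<length fs. y j \<in> carrier (poly_ring_on Z)" for y
  proof -
    interpret M: abelian_group "quot_module (poly_ring_on Z) J" by (rule abelian_group_quot_module[OF J])
    have fs': "fs ! j \<in> carrier (poly_ring_on Z)" if "j < length fs" for j
      using fs that nth_mem by blast
    have m: "fs ! j * y j \<in> carrier (poly_ring_on Z)" if "j < length fs" for j
      using y fs' that poly_ring_closed(2)[of "fs ! j" Z "y j"] by blast
    have "(\<Oplus>\<^bsub>quot_module (poly_ring_on Z) J\<^esub> j\<in>{..<length fs}.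
      (fs ! j) \<odot>\<^bsub>quot_module (poly_ring_on Z) J\<^esub> coset Z J (y j)) =
      (\<Oplus>\<^bsub>quot_module (poly_ring_on Z) J\<^esub> j\<in>{..<length fs}. coset Z J (fs ! j * y j))"
      using y fs' m
      by (intro M.finsum_cong') (auto simp: smult_quot_module[OF J] carrier_quot_module[OF J])
    also have "\<dots> = coset Z J (\<Sum>j<length fs. fs ! j * y j)"
      using m by (intro finsum_quot_module[OF J]) auto
    finally show ?thesis .
  qed
  show ?thesis
  proof
    show "?l \<subseteq> ?r"
    proof
      fix X assume "X \<in> ?l"
      then obtain Y where Y: "Y \<in> {..<length fs} \<rightarrow> carrier (quot_module (poly_ring_on Z) J)"
        "X = (\<Oplus>\<^bsub>quot_module (poly_ring_on Z) J\<^esub> j\<in>{..<length fs}.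
          (fs ! j) \<odot>\<^bsub>quot_module (poly_ring_on Z) J\<^esub> Y j)"
        by (auto simp: list_smult_def)
      have "\<forall>j\<in>{..<length fs}. \<exists>p. p \<in> carrier (poly_ring_on Z) \<and> Y j = coset Z J p"
        using Y(1) carrier_quot_module[OF J] by blast
      then obtain y where y: "\<forall>j\<in>{..<length fs}. y j \<in> carrier (poly_ring_on Z) \<and> Y j = coset Z J (y j)"
        by metis
      have "X = (\<Oplus>\<^bsub>quot_module (poly_ring_on Z) J\<^esub> j\<in>{..<length fs}.
          (fs ! j) \<odot>\<^bsub>quot_module (poly_ring_on Z) J\<^esub> coset Z J (y j))"
      proof -
        interpret M: abelian_group "quot_module (poly_ring_on Z) J" by (rule abelian_group_quot_module[OF J])
        have "fs ! j * y j \<in> carrier (poly_ring_on Z)" "fs ! j \<in> carrier (poly_ring_on Z)" if "j < length fs" for j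
          using fs that nth_mem poly_ring_closed(2)[of "fs ! j" Z "y j"] y by (blast, blast)
        then show ?thesis unfolding Y(2)
          using y by (intro M.finsum_cong') (auto simp: smult_quot_module[OF J] carrier_quot_module[OF J])
      qed
      then have "X = coset Z J (\<Sum>j<length fs. fs ! j * y j)" using sum[of y] y by blast
      moreover have "0 + (\<Sum>j<length fs. fs ! j * y j) \<in> sum_ideal Z J fs"
        unfolding sum_ideal_def using y ideal_closed(1)[OF J] by blast
      ultimately show "X \<in> ?r" by simp
    qed
    show "?r \<subseteq> ?l"
    proof
      fix X assume "X \<in> ?r"
      then obtain a y where y: "a \<in> J" "\<forall>j<length fs. y j \<in> carrier (poly_ring_on Z)"
        "X = coset Z J (a + (\<Sum>j<length fs. fs ! j * y j))" unfolding sum_ideal_def by blast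
      then have "X = coset Z J (\<Sum>j<length fs. fs ! j * y j)" by (simp add: coset_eq_iff[OF J])
      then show "X \<in> ?l" unfolding list_smult_def sum[OF y(2), symmetric]
        using y(2) by (intro CollectI exI[of _ "\<lambda>j. coset Z J (y j)"]) (auto simp: carrier_quot_module[OF J])
    qed
  qed
qed

text \<open>As L contains J, membership in L does not depend on the representative of a
  coset.\<close>

lemma coset_mem_image_iff:
  fixes J :: "'k::field mpoly set"
  assumes J: "ideal J (poly_ring_on Z)" and L: "ideal L (poly_ring_on Z)" and "J \<subseteq> L"
  shows "coset Z J p \<in> coset Z J ` L \<longleftrightarrow> p \<in> L"
proof
  assume "coset Z J p \<in> coset Z J ` L"
  then obtain q where q: "q \<in> L" "p - q \<in> J" using coset_eq_iff[OF J] by blast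
  then have "p - q + q \<in> L" using assms(3) ideal_closed(3)[OF L, of "p - q" q] by blast
  then show "p \<in> L" by simp
qed blast

lemma regular_sequence_quot_module:
  fixes J :: "'k::field mpoly set"
  assumes J: "ideal J (poly_ring_on Z)" and fs: "set fs \<subseteq> carrier (poly_ring_on Z)"
  shows "regular_sequence (quot_module (poly_ring_on Z) J) fs \<longleftrightarrow> regular Z J fs"
proof -
  have mem: "coset Z J p \<in> list_smult gs (quot_module (poly_ring_on Z) J) \<longleftrightarrow> p \<in> sum_ideal Z J gs"
    if "set gs \<subseteq> carrier (poly_ring_on Z)" for p gs
    unfolding list_smult_quot_module[OF J that]
    by (rule coset_mem_image_iff[OF J sum_ideal_ideal[OF J that] sum_ideal_mono[OF J]])
  have tk: "set (take j fs) \<subseteq> carrier (poly_ring_on Z)" for j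
    using fs set_take_subset by (rule order_trans[rotated])
  have "list_smult fs (quot_module (poly_ring_on Z) J) = carrier (quot_module (poly_ring_on Z) J) \<longleftrightarrow>
    sum_ideal Z J fs = carrier (poly_ring_on Z)"
  proof
    assume *: "list_smult fs (quot_module (poly_ring_on Z) J) = carrier (quot_module (poly_ring_on Z) J)"
    have "p \<in> sum_ideal Z J fs" if "p \<in> carrier (poly_ring_on Z)" for p
      using mem[OF fs, of p] that unfolding * carrier_quot_module[OF J] by blast
    then show "sum_ideal Z J fs = carrier (poly_ring_on Z)"
      using ideal_closed(2)[OF sum_ideal_ideal[OF J fs]] by blast
  qed (simp add: list_smult_quot_module[OF J fs] carrier_quot_module[OF J])
  moreover have "(\<forall>y\<in>carrier (quot_module (poly_ring_on Z) J).
        (fs ! j) \<odot>\<^bsub>quot_module (poly_ring_on Z) J\<^esub> y \<in> list_smult (take j fs) (quot_module (poly_ring_on Z) J) \<longrightarrow>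
        y \<in> list_smult (take j fs) (quot_module (poly_ring_on Z) J)) \<longleftrightarrow>
    (\<forall>y\<in>carrier (poly_ring_on Z). fs ! j * y \<in> sum_ideal Z J (take j fs) \<longrightarrow> y \<in> sum_ideal Z J (take j fs))"
    if "j < length fs" for j
  proof -
    have "fs ! j \<in> carrier (poly_ring_on Z)" using that fs nth_mem by blast
    then show ?thesis
      unfolding carrier_quot_module[OF J] by (simp add: smult_quot_module[OF J] mem[OF tk])
  qed
  ultimately show ?thesis
    unfolding regular_sequence_def regular_iff_sum_ideal by blast
qed

text \<open>J is the preimage of J' under a surjective ring map, so h induces an isomorphism of the
  quotients. The relation between the two ideals survives the passage to J + (f) and J' + (h f),
  which is what the induction needs.\<close>

lemma regular_map:
  fixes J :: "'k::field mpoly set" and h :: "'k mpoly \<Rightarrow> 'k mpoly"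
  assumes add: "\<And>p q. h (p + q) = h p + h q"
    and mult: "\<And>p q. p \<in> carrier (poly_ring_on Z) \<Longrightarrow> q \<in> carrier (poly_ring_on Z) \<Longrightarrow> h (p * q) = h p * h q"
    and surj: "h ` carrier (poly_ring_on Z) = carrier (poly_ring_on Z')"
  shows "ideal J (poly_ring_on Z) \<Longrightarrow> ideal J' (poly_ring_on Z') \<Longrightarrow>
    (\<And>p. p \<in> carrier (poly_ring_on Z) \<Longrightarrow> p \<in> J \<longleftrightarrow> h p \<in> J') \<Longrightarrow>
    set fs \<subseteq> carrier (poly_ring_on Z) \<Longrightarrow> regular Z J fs \<Longrightarrow> regular Z' J' (map h fs)"
proof (induction fs arbitrary: J J')
  case Nil
  then have "J \<subset> carrier (poly_ring_on Z)"
    using ideal_closed(2)[OF Nil(1)] by auto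
  then obtain p where p: "p \<in> carrier (poly_ring_on Z)" "p \<notin> J"
    by blast
  have "h p \<in> carrier (poly_ring_on Z')" using p(1) surj by blast
  moreover have "h p \<notin> J'" using Nil(3)[OF p(1)] p(2) by blast
  ultimately show ?case by auto
next
  case (Cons f fs)
  note J = Cons.prems(1) and J' = Cons.prems(2) and JJ' = Cons.prems(3)
  have f: "f \<in> carrier (poly_ring_on Z)" and fs: "set fs \<subseteq> carrier (poly_ring_on Z)"
    using Cons.prems(4) by auto
  have hf: "h f \<in> carrier (poly_ring_on Z')" using f surj by blast
  have *: "p \<in> extend_ideal Z J f \<longleftrightarrow> h p \<in> extend_ideal Z' J' (h f)"
    if p: "p \<in> carrier (poly_ring_on Z)" for p
  proof
    assume "p \<in> extend_ideal Z J f"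
    then obtain a r where a: "p = a + f * r" "a \<in> J" "r \<in> carrier (poly_ring_on Z)"
      by (auto simp: extend_ideal_def)
    have "h p = h a + h f * h r" using mult[OF f a(3)] by (simp add: a(1) add)
    moreover have "h a \<in> J'" using JJ'[OF ideal_closed(2)[OF J a(2)]] a(2) by blast
    moreover have "h r \<in> carrier (poly_ring_on Z')" using a(3) surj by blast
    ultimately show "h p \<in> extend_ideal Z' J' (h f)" unfolding extend_ideal_def by blast
  next
    assume "h p \<in> extend_ideal Z' J' (h f)"
    then obtain a r where a: "h p = a + h f * r" "a \<in> J'" "r \<in> h ` carrier (poly_ring_on Z)"
      unfolding surj by (auto simp: extend_ideal_def)
    then obtain s where s: "r = h s" "s \<in> carrier (poly_ring_on Z)" by blast
    \<comment> \<open>Surjectivity has lifted the multiplier r to s; the remainder p - f s is mapped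
      to a in J' and hence lies in J.\<close>
    have "h (p - f * s) + h (f * s) = h p" by (simp flip: add)
    then have "h (p - f * s) = a" using a(1) s mult[OF f s(2)] by simp
    then have "p - f * s \<in> J"
      using JJ'[of "p - f * s"] a(2) poly_ring_closed(4)[OF p poly_ring_closed(2)[OF f s(2)]] by simp
    moreover have "p = (p - f * s) + f * s" by simp
    ultimately show "p \<in> extend_ideal Z J f" unfolding extend_ideal_def using s(2) by blast
  qed
  have "regular Z (extend_ideal Z J f) fs" using Cons.prems(5) by simp
  with * have "regular Z' (extend_ideal Z' J' (h f)) (map h fs)"
    by (rule Cons.IH[of "extend_ideal Z J f" "extend_ideal Z' J' (h f)",
          OF ideal_extend_ideal[OF J f] ideal_extend_ideal[OF J' hf] _ fs])
  moreover have "\<forall>y\<in>carrier (poly_ring_on Z'). h f * y \<in> J' \<longrightarrow> y \<in> J'"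
  proof (intro ballI impI)
    fix y assume that: "y \<in> carrier (poly_ring_on Z')" "h f * y \<in> J'"
    from that(1)[folded surj] obtain z where z: "y = h z" "z \<in> carrier (poly_ring_on Z)"
      by (rule imageE)
    then have "f * z \<in> J" using JJ'[OF poly_ring_closed(2)[OF f z(2)]] mult[OF f z(2)] that(2) by simp
    moreover have "\<forall>y\<in>carrier (poly_ring_on Z). f * y \<in> J \<longrightarrow> y \<in> J"
      using Cons.prems(5) unfolding regular.simps by (rule conjunct1)
    ultimately have "z \<in> J" using z(2) by simp
    then show "y \<in> J'" using z(1) JJ'[OF z(2)] by blast
  qed
  ultimately show ?case unfolding regular.simps list.map by (intro conjI)
qed


section \<open>Depth is at most the number of variables\<close>

definition exponent_lists :: "nat \<Rightarrow> nat \<Rightarrow> nat list set" where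
  "exponent_lists N d = {xs. set xs \<subseteq> {..N} \<and> length xs = d}"

definition power_product :: "'k::field mpoly list \<Rightarrow> nat list \<Rightarrow> 'k mpoly" where
  "power_product fs xs = prod_list (map2 (^) fs xs)"

lemma card_exponent_lists: "card (exponent_lists N d) = (N + 1) ^ d"
  by (simp add: exponent_lists_def card_lists_length_eq)

lemma finite_exponent_lists: "finite (exponent_lists N d)"
  by (simp add: exponent_lists_def finite_lists_length_eq)

lemma exponent_lists_Suc:
  "exponent_lists N (Suc d) = (\<lambda>(k, xs). k # xs) ` ({..<Suc N} \<times> exponent_lists N d)"
  by (auto simp: exponent_lists_def length_Suc_conv image_iff less_Suc_eq_le)

lemma poly_ring_on_power:
  "p \<in> carrier (poly_ring_on Z) \<Longrightarrow> p ^ k \<in> carrier (poly_ring_on Z :: 'k::field mpoly ring)"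
  by (induction k) (simp_all add: poly_ring_closed(2))

lemma power_product_closed:
  "set fs \<subseteq> carrier (poly_ring_on Z) \<Longrightarrow> power_product fs xs \<in> carrier (poly_ring_on Z :: 'k::field mpoly ring)"
proof (induction fs arbitrary: xs)
  case (Cons f fs)
  then show ?case
    by (cases xs) (auto simp: power_product_def intro!: poly_ring_closed(2) poly_ring_on_power)
qed (simp add: power_product_def)

lemma single_zero_closed: "Poly_Mapping.single 0 c \<in> carrier (poly_ring_on Z :: 'k::field mpoly ring)"
  by (simp add: poly_ring_on_simps(1))

text \<open>Modulo J, a nonzerodivisor f behaves like an indeterminate as long as each coefficient
  is 0 or outside J + (f). The sum is G 0 + f R, so G 0 lies in J + (f) and vanishes; then f R is in
  J, f can be cancelled, and R is a sum of the same kind with one term fewer.\<close>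

lemma regular_power_sum:
  fixes J :: "'k::field mpoly set"
  assumes J: "ideal J (poly_ring_on Z)" and f: "f \<in> carrier (poly_ring_on Z)"
    and reg: "\<And>y. y \<in> carrier (poly_ring_on Z) \<Longrightarrow> f * y \<in> J \<Longrightarrow> y \<in> J"
  shows "(\<And>k. G k \<in> carrier (poly_ring_on Z)) \<Longrightarrow>
    (\<And>k. k < M \<Longrightarrow> G k \<in> extend_ideal Z J f \<Longrightarrow> G k = 0) \<Longrightarrow>
    (\<Sum>k<M. f ^ k * G k) \<in> J \<Longrightarrow> k < M \<Longrightarrow> G k = 0"
proof (induction M arbitrary: G k)
  case (Suc M)
  let ?R = "\<Sum>k<M. f ^ k * G (Suc k)"
  have R: "?R \<in> carrier (poly_ring_on Z)"
    by (rule poly_ring_on_sum) (intro poly_ring_closed(2) poly_ring_on_power f Suc.prems(1))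
  have *: "(\<Sum>k<Suc M. f ^ k * G k) = G 0 + f * ?R"
    unfolding sum.lessThan_Suc_shift by (simp add: sum_distrib_left mult.assoc)
  have "G 0 = (\<Sum>k<Suc M. f ^ k * G k) + f * (- ?R)"
    unfolding * by (simp add: algebra_simps)
  then have "G 0 \<in> extend_ideal Z J f"
    unfolding extend_ideal_def using Suc.prems(3) poly_ring_closed(3)[OF R R] by blast
  then have G0: "G 0 = 0" using Suc.prems(2)[of 0] by blast
  then have "?R \<in> J" using Suc.prems(3) reg[OF R] unfolding * by simp
  then have IH: "G (Suc k) = 0" if "k < M" for k
    by (intro Suc.IH[of "\<lambda>k. G (Suc k)", OF Suc.prems(1) Suc.prems(2)]) (use that in auto)
  show ?case using G0 IH Suc.prems(4) by (cases k) auto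
qed simp

text \<open>Independence is proved modulo J, so that the induction can replace J by J + (f). When
  the sum is sorted by the exponent k of f, its coefficients G k are combinations of power products
  of the remaining elements, and \<open>regular_power_sum\<close> applies to them.\<close>

lemma regular_power_products_independent:
  fixes J :: "'k::field mpoly set"
  shows "ideal J (poly_ring_on Z) \<Longrightarrow> set fs \<subseteq> carrier (poly_ring_on Z) \<Longrightarrow> regular Z J fs \<Longrightarrow>
    (\<Sum>xs\<in>exponent_lists N (length fs). Poly_Mapping.single 0 (c xs) * power_product fs xs) \<in> J \<Longrightarrow>
    xs \<in> exponent_lists N (length fs) \<Longrightarrow> c xs = 0"
proof (induction fs arbitrary: J c xs)
  case Nil
  have e: "exponent_lists N 0 = {[]}" by (auto simp: exponent_lists_def)
  have "Poly_Mapping.single 0 (c []) \<in> J" and xs: "xs = []"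
    using Nil.prems by (simp_all add: e power_product_def)
  show ?case
  proof (rule ccontr)
    assume "c xs \<noteq> 0"
    \<comment> \<open>A nonzero constant in J is invertible and would make J the whole ring.\<close>
    then have "Poly_Mapping.single 0 (inverse (c [])) * Poly_Mapping.single 0 (c []) = (1 :: 'k mpoly)"
      by (simp add: mult_single xs)
    then have "1 \<in> J"
      using ideal_closed(7)[OF Nil.prems(1) \<open>Poly_Mapping.single 0 (c []) \<in> J\<close> single_zero_closed[of "inverse (c [])"]]
      by simp
    then have "p \<in> J" if "p \<in> carrier (poly_ring_on Z)" for p
      using ideal_closed(7)[OF Nil.prems(1) _ that] by fastforce
    then show False using Nil.prems(3) ideal_closed(2)[OF Nil.prems(1)] by auto
  qed
next
  case (Cons f fs)
  note J = Cons.prems(1)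
  have f: "f \<in> carrier (poly_ring_on Z)" and fs: "set fs \<subseteq> carrier (poly_ring_on Z)"
    using Cons.prems(2) by auto
  let ?L = "exponent_lists N (length fs)"
  define G where "G k = (\<Sum>ys\<in>?L. Poly_Mapping.single 0 (c (k # ys)) * power_product fs ys)" for k
  have "(\<Sum>xs\<in>exponent_lists N (length (f # fs)). Poly_Mapping.single 0 (c xs) * power_product (f # fs) xs)
    = (\<Sum>(k, ys)\<in>{..<Suc N} \<times> ?L. Poly_Mapping.single 0 (c (k # ys)) * power_product (f # fs) (k # ys))"
    unfolding length_Cons exponent_lists_Suc
    by (subst sum.reindex) (auto simp: inj_on_def o_def case_prod_beta)
  also have "\<dots> = (\<Sum>k<Suc N. f ^ k * G k)"
    unfolding G_def sum.cartesian_product[symmetric] sum_distrib_left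
    by (intro sum.cong) (auto simp: power_product_def ac_simps)
  finally have "(\<Sum>k<Suc N. f ^ k * G k) \<in> J" using Cons.prems(4) by simp
  \<comment> \<open>The tail is regular modulo J + (f), so by the induction hypothesis a G k in that
    ideal has only zero coefficients.\<close>
  have c0: "c (k # ys) = 0" if "G k \<in> extend_ideal Z J f" "ys \<in> ?L" for k ys
    using Cons.prems(3) that
    by (intro Cons.IH[where c = "\<lambda>ys. c (k # ys)", OF ideal_extend_ideal[OF J f] fs])
       (simp_all add: G_def)
  have "G k \<in> carrier (poly_ring_on Z)" for k
    unfolding G_def
    by (intro poly_ring_on_sum poly_ring_closed(2) single_zero_closed power_product_closed fs)
  moreover have "G k = 0" if "G k \<in> extend_ideal Z J f" for k
    unfolding G_def by (rule sum.neutral) (simp add: c0[OF that])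
  moreover have "y \<in> J" if "y \<in> carrier (poly_ring_on Z)" "f * y \<in> J" for y
    using bspec[OF conjunct1[OF Cons.prems(3)[unfolded regular.simps]] that(1)] that(2) by (rule mp)
  ultimately have "G k = 0" if "k < Suc N" for k
    using regular_power_sum[OF J f, of G "Suc N" k] \<open>(\<Sum>k<Suc N. f ^ k * G k) \<in> J\<close> that by blast
  moreover obtain k ys where "xs = k # ys" "k < Suc N" "ys \<in> ?L"
    using Cons.prems(5) unfolding length_Cons exponent_lists_Suc by auto
  \<comment> \<open>G k = 0 lies in J + (f), so \<open>c0\<close> applies once more and yields the
    vanishing of the single coefficients.\<close>
  ultimately show ?case
    using c0[of k ys] ideal_closed(1)[OF ideal_extend_ideal[OF J f]] by simp
qed

section \<open>Counting monomials with bounded exponents\<close>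

definition box :: "nat \<Rightarrow> nat \<Rightarrow> expo set" where
  "box n b = {m \<in> expos n. \<forall>i. lookup m i \<le> b}"

lemma box_mono: "b \<le> b' \<Longrightarrow> box n b \<subseteq> box n b'"
  by (auto simp: box_def intro: order_trans)

lemma finite_box: "finite (box n b)" and card_box: "card (box n b) \<le> (b + 1) ^ n"
proof -
  let ?g = "\<lambda>m :: expo. map (lookup m) [0..<n]"
  have "inj_on ?g (box n b)"
  proof (rule inj_onI, rule poly_mapping_eqI)
    fix m m' i assume m: "m \<in> box n b" "m' \<in> box n b" "?g m = ?g m'"
    show "lookup m i = lookup m' i"
    proof (cases "i < n")
      case True
      then show ?thesis using arg_cong[OF m(3), of "\<lambda>xs. xs ! i"] by simp
    next
      case False
      then have "i \<notin> keys m" "i \<notin> keys m'" using m(1,2) by (auto simp: box_def expos_def)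
      then show ?thesis by (simp add: in_keys_iff)
    qed
  qed
  moreover have "?g ` box n b \<subseteq> exponent_lists b n"
    by (auto simp: box_def exponent_lists_def)
  ultimately show "finite (box n b)" "card (box n b) \<le> (b + 1) ^ n"
    using card_inj_on_le[of ?g "box n b" "exponent_lists b n"] finite_exponent_lists[of b n]
      inj_on_finite card_exponent_lists[of b n] by (blast, simp)
qed

text \<open>Each exponent is bounded separately, not the total degree: the bounds still add under
  multiplication, and \<open>card_box\<close> is a plain power.\<close>

lemma keys_mult_box: "keys p \<subseteq> box n a \<Longrightarrow> keys q \<subseteq> box n b \<Longrightarrow> keys (p * q) \<subseteq> box n (a + b)"
  for p q :: "'k::field mpoly"
  using keys_mult[of p q] by (force simp: box_def expos_add lookup_add intro: add_mono)

lemma keys_power_box: "keys p \<subseteq> box n a \<Longrightarrow> keys (p ^ k) \<subseteq> box n (k * a)"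
  for p :: "'k::field mpoly"
proof (induction k)
  case 0
  then show ?case by (auto simp: box_def expos_def)
next
  case (Suc k)
  then show ?case using keys_mult_box[of p n a "p ^ k" "k * a"] by simp
qed

lemma keys_power_product_box:
  fixes fs :: "'k::field mpoly list"
  assumes "\<forall>f\<in>set fs. keys f \<subseteq> box n D" "xs \<in> exponent_lists N (length fs)"
  shows "keys (power_product fs xs) \<subseteq> box n (length fs * (N * D))"
  using assms
proof (induction fs arbitrary: xs)
  case Nil
  then show ?case by (auto simp: power_product_def exponent_lists_def box_def expos_def)
next
  case (Cons f fs)
  then obtain k ys where xs: "xs = k # ys" "k \<le> N" "ys \<in> exponent_lists N (length fs)"
    unfolding length_Cons exponent_lists_Suc by auto
  have "keys (f ^ k) \<subseteq> box n (N * D)"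
    using keys_power_box[of f n D k] box_mono[of "k * D" "N * D" n] Cons.prems xs(2) by fastforce
  from keys_mult_box[OF this Cons.IH[OF _ xs(3)]] show ?case
    using Cons.prems by (simp add: power_product_def xs(1))
qed

lemma keys_subset_box:
  fixes fs :: "'k::field mpoly list"
  assumes "set fs \<subseteq> carrier (poly_ring n)"
  shows "\<exists>D. \<forall>f\<in>set fs. keys f \<subseteq> box n D"
proof -
  let ?M = "\<Union>f\<in>set fs. keys f"
  let ?V = "(\<lambda>(m, i). lookup m i) ` (?M \<times> {..<n})"
  have "lookup m i \<le> Max (insert 0 ?V)" if "m \<in> ?M" for m i
  proof (cases "i \<in> keys m")
    case True
    moreover have "m \<in> expos n" using that assms unfolding carrier_poly_ring[abs_def] subset_iff by blast
    ultimately have "i < n" by (auto simp: expos_def)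
    then have "lookup m i \<in> ?V" using that by force
    then show ?thesis by (intro Max_ge) auto
  qed (simp add: in_keys_iff)
  then show ?thesis
    using assms by (intro exI[of _ "Max (insert 0 ?V)"]) (auto simp: box_def carrier_poly_ring subset_iff)
qed

text \<open>Scalars act as constant polynomials. The instance supplies
  \<open>independent_span_bound\<close>, which compares an independent set with a finite spanning
  set.\<close>

lemma vector_space_poly: "vector_space (\<lambda>c (p :: 'k::field mpoly). Poly_Mapping.single 0 c * p)"
  by unfold_locales (simp_all add: distrib_left distrib_right single_add mult_single flip: mult.assoc)

text \<open>A regular sequence in a quotient of a \<open>K\<close>-algebra is algebraically independent over \<open>K\<close>. As its power
  products with exponents at most \<open>N\<close> involve only monomials with exponents \<open>O(N)\<close>, counting both shows
  that there are at most \<open>n\<close> elements.\<close>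

lemma length_regular_le:
  fixes J :: "'k::field mpoly set"
  assumes J: "ideal J (poly_ring n)" and fs: "set fs \<subseteq> carrier (poly_ring n)" and reg: "regular {..<n} J fs"
  shows "length fs \<le> n"
proof (rule ccontr)
  assume d: "\<not> length fs \<le> n"
  let ?d = "length fs"
  obtain D where D: "\<forall>f\<in>set fs. keys f \<subseteq> box n D" using keys_subset_box[OF fs] by blast
  \<comment> \<open>With d = \<open>length fs\<close>, counting gives
    \<open>(N+1)^d \<le> (d*N*D+1)^n \<le> (N+1)^n * (d*D+1)^n\<close>. N is chosen as the last
    factor, so that d > n would force \<open>(N+1)^(n+1) \<le> (N+1)^n * N\<close>.\<close>
  define N where "N = (?d * D + 1) ^ n"
  let ?L = "exponent_lists N ?d"
  interpret vector_space "\<lambda>c (p :: 'k mpoly). Poly_Mapping.single 0 c * p" by (rule vector_space_poly)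
  note indep = regular_power_products_independent[OF J fs reg, of _ N]
  \<comment> \<open>\<open>independent\<close> speaks of the set of power products, where
    coincidences would be lost from the count. Two equal products would satisfy the relation with
    coefficients 1 and -1.\<close>
  have inj: "inj_on (power_product fs) ?L"
  proof (rule inj_onI, rule ccontr)
    fix xs ys assume xy: "xs \<in> ?L" "ys \<in> ?L" "power_product fs xs = power_product fs ys" "xs \<noteq> ys"
    define c :: "nat list \<Rightarrow> 'k" where "c = (\<lambda>zs. if zs = xs then 1 else if zs = ys then - 1 else 0)"
    have "(\<Sum>zs\<in>?L. Poly_Mapping.single 0 (c zs) * power_product fs zs) =
      (\<Sum>zs\<in>{xs, ys}. Poly_Mapping.single 0 (c zs) * power_product fs zs)"
      using xy finite_exponent_lists by (intro sum.mono_neutral_right) (auto simp: c_def)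
    also have "\<dots> = 0" using xy by (auto simp: c_def single_uminus)
    finally have "c xs = 0" using indep[of c xs] xy(1) ideal_closed(1)[OF J] by simp
    then show False by (simp add: c_def)
  qed
  have "independent (power_product fs ` ?L)"
  proof
    assume "dependent (power_product fs ` ?L)"
    then obtain u where u: "\<exists>v\<in>power_product fs ` ?L. u v \<noteq> 0"
      "(\<Sum>v\<in>power_product fs ` ?L. Poly_Mapping.single 0 (u v) * v) = 0"
      using finite_exponent_lists by (auto simp: dependent_finite)
    from u(2) have "(\<Sum>xs\<in>?L. Poly_Mapping.single 0 (u (power_product fs xs)) * power_product fs xs) = 0"
      by (simp add: sum.reindex[OF inj])
    then show False
      using indep[of "\<lambda>xs. u (power_product fs xs)"] ideal_closed(1)[OF J] u(1) by auto
  qed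
  moreover have "power_product fs ` ?L \<subseteq> span (monomial ` box n (?d * (N * D)))"
  proof (rule image_subsetI)
    fix xs assume "xs \<in> ?L"
    then have "keys (power_product fs xs) \<subseteq> box n (?d * (N * D))"
      by (rule keys_power_product_box[OF D])
    then have "Poly_Mapping.single 0 c * monomial m \<in> span (monomial ` box n (?d * (N * D)))"
      if "m \<in> keys (power_product fs xs)" for m c
      using that by (intro span_scale span_base) blast
    then show "power_product fs xs \<in> span (monomial ` box n (?d * (N * D)))"
      by (subst poly_mapping_sum_single, intro span_sum) (simp add: monomial_def mult_single)
  qed
  ultimately have "card (power_product fs ` ?L) \<le> card (monomial ` box n (?d * (N * D)) :: 'k mpoly set)"
    using independent_span_bound[of "monomial ` box n (?d * (N * D))"] finite_box by blast
  also have "\<dots> \<le> (?d * (N * D) + 1) ^ n"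
    using card_image_le[OF finite_box] card_box order_trans by blast
  also have "\<dots> \<le> ((N + 1) * (?d * D + 1)) ^ n"
    by (intro power_mono) (auto simp: algebra_simps)
  finally have "(N + 1) ^ ?d \<le> (N + 1) ^ n * N"
    unfolding card_image[OF inj] card_exponent_lists power_mult_distrib by (simp only: N_def)
  moreover have "(N + 1) ^ Suc n \<le> (N + 1) ^ ?d"
    using d by (intro power_increasing) auto
  ultimately have "(N + 1) ^ Suc n \<le> (N + 1) ^ n * N" by (rule order_trans[rotated])
  then have "(N + 1) ^ n * (N + 1) \<le> (N + 1) ^ n * N" by (simp only: power_Suc2)
  then show False by simp
qed

section \<open>Depth of S/J in terms of ideals of S\<close>

lemma max_ideal_subset: "max_ideal n \<subseteq> (carrier (poly_ring n) :: 'k::field mpoly set)"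
  unfolding max_ideal_eq subset_iff carrier_poly_ring by blast

lemma depth_quot_alt:
  fixes J :: "'k::field mpoly set"
  assumes J: "ideal J (poly_ring n)"
  shows "depth_quot n J = (SUP fs \<in> {fs. set fs \<subseteq> max_ideal n \<and> regular {..<n} J fs}. enat (length fs))"
proof -
  have "{fs. set fs \<subseteq> max_ideal n \<and> regular_sequence (quot_module (poly_ring n) J) fs} =
    {fs. set fs \<subseteq> max_ideal n \<and> regular {..<n} J fs}"
    using regular_sequence_quot_module[OF J] max_ideal_subset[of n] by (meson order_trans)
  then show ?thesis by (simp add: depth_quot_def depth_def)
qed

lemma depth_quot_le:
  fixes J :: "'k::field mpoly set"
  assumes J: "ideal J (poly_ring n)"
  shows "depth_quot n J \<le> enat n"
  unfolding depth_quot_alt[OF J]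
proof (rule SUP_least)
  fix fs :: "'k mpoly list"
  assume "fs \<in> {fs. set fs \<subseteq> max_ideal n \<and> regular {..<n} J fs}"
  then have "set fs \<subseteq> carrier (poly_ring n)" "regular {..<n} J fs" using max_ideal_subset by auto
  then show "enat (length fs) \<le> enat n" using length_regular_le[OF J] by simp
qed


section \<open>Eliminating a variable\<close>

text \<open>A transposition is its own inverse, so images under the renaming are preimages
  (\<open>involution_image\<close>) and one map serves both directions. For i = j it is the
  identity.\<close>

definition swap_vars :: "nat \<Rightarrow> nat \<Rightarrow> expo \<Rightarrow> expo" where
  "swap_vars i j = Poly_Mapping.map_key (transpose i j)"

definition relabel :: "nat \<Rightarrow> nat \<Rightarrow> 'k::field mpoly \<Rightarrow> 'k mpoly" where
  "relabel i j = Poly_Mapping.map_key (swap_vars i j)"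

text \<open>Substitutes \<open>0\<close> for \<open>x\<^sub>i\<close> and then renames \<open>x\<^sub>n\<close> to \<open>x\<^sub>i\<close>.\<close>

definition eliminate :: "nat \<Rightarrow> nat \<Rightarrow> 'k::field mpoly \<Rightarrow> 'k mpoly" where
  "eliminate i n p = relabel i n (Poly_Mapping.mapp (\<lambda>m c. c when lookup m i = 0) p)"

definition eliminate_gens :: "nat \<Rightarrow> nat \<Rightarrow> expo set \<Rightarrow> expo set" where
  "eliminate_gens i n A = swap_vars i n ` {a \<in> A. lookup a i = 0}"

lemma involution_image: "f ` A = {x. f x \<in> A}" if "\<And>x. f (f x) = x"
proof
  show "{x. f x \<in> A} \<subseteq> f ` A" using that by (metis (mono_tags) imageI mem_Collect_eq subsetI)
qed (auto simp: that)

lemma lookup_swap_vars [simp]: "lookup (swap_vars i j m) k = lookup m (transpose i j k)"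
  by (simp add: swap_vars_def map_key.rep_eq inj_transpose)

lemma swap_vars_involutory [simp]: "swap_vars i j (swap_vars i j m) = m"
  by (rule poly_mapping_eqI) simp

lemma inj_swap_vars: "inj (swap_vars i j)"
  by (rule inj_on_inverseI) (rule swap_vars_involutory)

lemma swap_vars_add: "swap_vars i j (a + b) = swap_vars i j a + swap_vars i j b"
  by (rule poly_mapping_eqI) (simp add: lookup_add)

lemma keys_swap_vars: "keys (swap_vars i j m) = transpose i j ` keys m"
  by (auto simp: in_keys_iff involution_image)

lemma expo_dvd_swap_vars: "expo_dvd (swap_vars i j a) m \<longleftrightarrow> expo_dvd a (swap_vars i j m)"
proof -
  have "(\<forall>k. lookup a (transpose i j k) \<le> lookup m k) \<longleftrightarrow>
      (\<forall>k. lookup a (transpose i j (transpose i j k)) \<le> lookup m (transpose i j k))"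
    using transpose_involutory by metis
  then show ?thesis by (simp add: expo_dvd_def)
qed

lemma lookup_relabel [simp]: "lookup (relabel i j p) m = lookup p (swap_vars i j m)"
  by (simp add: relabel_def map_key.rep_eq inj_swap_vars)

lemma keys_relabel: "keys (relabel i j p) = swap_vars i j ` keys p"
  by (auto simp: in_keys_iff involution_image)

lemma relabel_involutory [simp]: "relabel i j (relabel i j p) = p"
  by (rule poly_mapping_eqI) simp

lemma relabel_add: "relabel i j (p + q) = relabel i j p + relabel i j q"
  by (rule poly_mapping_eqI) (simp add: lookup_add)

text \<open>The absence of \<open>x\<^sub>i\<close> is tested before the renaming and therefore
  shows up as the absence of \<open>x\<^sub>n\<close> after it.\<close>

lemma lookup_eliminate:
  "lookup (eliminate i n p) m = (if lookup m n = 0 then lookup p (swap_vars i n m) else 0)"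
  by (auto simp: eliminate_def lookup_mapp when_def in_keys_iff)

lemma keys_eliminate: "keys (eliminate i n p) = swap_vars i n ` {m \<in> keys p. lookup m i = 0}"
  by (auto simp: in_keys_iff involution_image lookup_eliminate split: if_splits)

lemma eliminate_add: "eliminate i n (p + q) = eliminate i n p + eliminate i n q"
  by (rule poly_mapping_eqI) (simp add: lookup_add lookup_eliminate)

text \<open>Both sides are additive in p and in q, so comparing them on single terms
  suffices.\<close>

lemma poly_mapping_mult_homI:
  fixes h :: "'k::field mpoly \<Rightarrow> 'k mpoly"
  assumes add: "\<And>p q. h (p + q) = h p + h q"
    and single: "\<And>a b c d. h (Poly_Mapping.single (a + b) (c * d)) =
      h (Poly_Mapping.single a c) * h (Poly_Mapping.single b d)"
  shows "h (p * q) = h p * h q"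
proof -
  have "h 0 + h 0 = h 0" using add[of 0 0] by simp
  then have "h 0 = 0" by (metis add_cancel_right_right)
  then have sum: "h (sum g A) = (\<Sum>a\<in>A. h (g a))" for g :: "expo \<Rightarrow> 'k mpoly" and A
    by (induction A rule: infinite_finite_induct) (simp_all add: add)
  have "p * q = (\<Sum>a\<in>keys p. \<Sum>b\<in>keys q. Poly_Mapping.single (a + b) (lookup p a * lookup q b))"
    unfolding mult_single[symmetric] sum_product[symmetric] by (simp flip: poly_mapping_sum_single)
  then have "h (p * q) = (\<Sum>a\<in>keys p. h (Poly_Mapping.single a (lookup p a))) *
      (\<Sum>b\<in>keys q. h (Poly_Mapping.single b (lookup q b)))"
    by (simp add: sum single sum_product)
  then show ?thesis by (simp flip: sum poly_mapping_sum_single)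
qed

lemma relabel_mult: "relabel i j (p * q) = relabel i j p * relabel i j q"
proof (rule poly_mapping_mult_homI[OF relabel_add])
  have "relabel i j (Poly_Mapping.single a c) = Poly_Mapping.single (swap_vars i j a) c" for a and c :: 'a
    unfolding relabel_def
    by (metis inj_swap_vars map_key_single swap_vars_involutory)
  then show "relabel i j (Poly_Mapping.single (a + b) (c * d)) =
      relabel i j (Poly_Mapping.single a c) * relabel i j (Poly_Mapping.single b d)" for a b and c d :: 'a
    by (simp add: mult_single swap_vars_add)
qed

lemma eliminate_mult: "eliminate i n (p * q) = eliminate i n p * eliminate i n q"
proof (rule poly_mapping_mult_homI[OF eliminate_add])
  have "eliminate i n (Poly_Mapping.single a c) =
      (if lookup a i = 0 then Poly_Mapping.single (swap_vars i n a) c else 0)" for a and c :: 'a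
    by (rule poly_mapping_eqI) (auto simp: lookup_eliminate lookup_single when_def)
  then show "eliminate i n (Poly_Mapping.single (a + b) (c * d)) =
      eliminate i n (Poly_Mapping.single a c) * eliminate i n (Poly_Mapping.single b d)" for a b and c d :: 'a
    by (simp add: mult_single swap_vars_add lookup_add)
qed

lemma relabel_diff: "relabel i j (p - q) = relabel i j p - relabel i j q"
  by (rule poly_mapping_eqI) (simp add: lookup_minus)

lemma eliminate_diff: "eliminate i n (p - q) = eliminate i n p - eliminate i n q"
  by (rule poly_mapping_eqI) (simp add: lookup_minus lookup_eliminate)

lemma monomial_mem_mono_ideal:
  "monomial m \<in> (mono_ideal n A :: 'k::field mpoly set) \<longleftrightarrow> m \<in> expos n \<and> (\<exists>a\<in>A. expo_dvd a m)"
  by (simp add: mono_ideal_def)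

lemma mem_mono_ideal_iff:
  "p \<in> mono_ideal n A \<longleftrightarrow> p \<in> carrier (poly_ring n) \<and> (\<forall>m\<in>keys p. \<exists>a\<in>A. expo_dvd a m)"
  unfolding carrier_poly_ring by (auto simp: mono_ideal_def)

lemma relabel_poly_ring_on:
  "relabel i n ` carrier (poly_ring_on Z) = carrier (poly_ring_on (transpose i n ` Z) :: 'k::field mpoly ring)"
proof -
  have sub: "relabel i n ` carrier (poly_ring_on Z) \<subseteq>
    carrier (poly_ring_on (transpose i n ` Z) :: 'k mpoly ring)" for Z
    by (fastforce simp: poly_ring_on_simps(1) keys_relabel keys_swap_vars)
  show ?thesis
  proof
    show "carrier (poly_ring_on (transpose i n ` Z)) \<subseteq> (relabel i n ` carrier (poly_ring_on Z) :: 'k mpoly set)"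
    proof
      fix p :: "'k mpoly" assume "p \<in> carrier (poly_ring_on (transpose i n ` Z))"
      then have "relabel i n p \<in> carrier (poly_ring_on Z)"
        using sub[of "transpose i n ` Z"] by (auto simp: image_image)
      then show "p \<in> relabel i n ` carrier (poly_ring_on Z)"
        by (rule rev_image_eqI) simp
    qed
  qed (rule sub)
qed

text \<open>The discarded generators cannot divide m. Ideal membership, minimal generators and colon
  ideals are all transferred through this equivalence.\<close>

lemma eliminate_gens_dvd:
  assumes "lookup m i = 0"
  shows "(\<exists>a\<in>eliminate_gens i n A. expo_dvd a (swap_vars i n m)) \<longleftrightarrow> (\<exists>a\<in>A. expo_dvd a m)"
proof -
  have "expo_dvd a m \<Longrightarrow> lookup a i = 0" for a
    using assms by (metis expo_dvd_def le_zero_eq)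
  then show ?thesis
    by (auto simp: eliminate_gens_def expo_dvd_swap_vars)
qed

section \<open>Monomials without \<open>x\<^sub>i\<close> in n + 1 variables versus monomials in n
  variables\<close>

context
  fixes i n :: nat
  assumes i: "i \<le> n"
begin

lemma transpose_less: "transpose i n k \<noteq> i \<Longrightarrow> transpose i n k < Suc n \<longleftrightarrow> k < n"
  using i by (auto simp: transpose_def split: if_splits)

text \<open>\<open>lookup m n = 0\<close> says that the swapped exponent vector lacks
  \<open>x\<^sub>i\<close>, so the renaming matches the monomials of S without
  \<open>x\<^sub>i\<close> with those of S'.\<close>

lemma swap_vars_expos_iff:
  "swap_vars i n m \<in> expos (Suc n) \<and> lookup m n = 0 \<longleftrightarrow> m \<in> expos n"
proof
  assume m: "swap_vars i n m \<in> expos (Suc n) \<and> lookup m n = 0"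
  have "k < n" if "k \<in> keys m" for k
  proof -
    have "k \<noteq> n" using that m by (auto simp: in_keys_iff)
    then have "transpose i n k \<noteq> i" by (auto simp: transpose_eq_iff)
    moreover have "transpose i n k < Suc n"
      using m that by (auto simp: expos_def keys_swap_vars)
    ultimately show ?thesis using transpose_less by blast
  qed
  then show "m \<in> expos n" by (auto simp: expos_def)
next
  assume m: "m \<in> expos n"
  then have "lookup m n = 0" by (auto simp: expos_def in_keys_iff)
  moreover have "transpose i n k < Suc n" if "k < n" for k
    using that i by (auto simp: transpose_def)
  then have "swap_vars i n m \<in> expos (Suc n)"
    using m by (auto simp: expos_def keys_swap_vars)
  ultimately show "swap_vars i n m \<in> expos (Suc n) \<and> lookup m n = 0" by blast
qed

lemma expos_swap_vars: "m \<in> expos n \<Longrightarrow> swap_vars i n m \<in> expos (Suc n)"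
  "m \<in> expos n \<Longrightarrow> lookup m n = 0"
  "m \<in> expos (Suc n) \<Longrightarrow> lookup m i = 0 \<Longrightarrow> swap_vars i n m \<in> expos n"
  using swap_vars_expos_iff[of m] swap_vars_expos_iff[of "swap_vars i n m"] by auto

lemma relabel_closed:
  "p \<in> carrier (poly_ring n) \<Longrightarrow> relabel i n p \<in> carrier (poly_ring (Suc n) :: 'k::field mpoly ring)"
  unfolding carrier_poly_ring keys_relabel using expos_swap_vars(1) by blast

lemma eliminate_closed:
  "p \<in> carrier (poly_ring (Suc n)) \<Longrightarrow> eliminate i n p \<in> carrier (poly_ring n :: 'k::field mpoly ring)"
  unfolding carrier_poly_ring keys_eliminate using expos_swap_vars(3) by blast

lemma eliminate_relabel: "p \<in> carrier (poly_ring n) \<Longrightarrow> eliminate i n (relabel i n p) = p"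
  for p :: "'k::field mpoly"
proof (rule poly_mapping_eqI)
  fix m assume p: "p \<in> carrier (poly_ring n)"
  show "lookup (eliminate i n (relabel i n p)) m = lookup p m"
  proof (cases "m \<in> keys p")
    case True
    then have "lookup m n = 0" using p expos_swap_vars(2) unfolding carrier_poly_ring by blast
    then show ?thesis by (simp add: lookup_eliminate)
  qed (simp add: lookup_eliminate in_keys_iff)
qed

lemma eliminate_surj:
  "eliminate i n ` carrier (poly_ring (Suc n)) = carrier (poly_ring n :: 'k::field mpoly ring)"
proof
  show "carrier (poly_ring n :: 'k mpoly ring) \<subseteq> eliminate i n ` carrier (poly_ring (Suc n))"
    using eliminate_relabel relabel_closed by (metis image_eqI subsetI)
qed (use eliminate_closed in blast)

lemma eliminate_gens_expos: "A \<subseteq> expos (Suc n) \<Longrightarrow> eliminate_gens i n A \<subseteq> expos n"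
  using expos_swap_vars(3) by (auto simp: eliminate_gens_def)

text \<open>Terms divisible by \<open>x\<^sub>i\<close> belong to the ideal on the left and are
  deleted by \<open>eliminate\<close>; the others are compared by \<open>eliminate_gens_dvd\<close>.
  With \<open>eliminate_surj\<close> this encodes the isomorphism of \<open>S/(I, x\<^sub>i)\<close>
  with S'/I'.\<close>

lemma eliminate_mem_iff:
  assumes p: "p \<in> carrier (poly_ring (Suc n))"
  shows "p \<in> mono_ideal (Suc n) (insert (Poly_Mapping.single i 1) A) \<longleftrightarrow>
    eliminate i n p \<in> (mono_ideal n (eliminate_gens i n A) :: 'k::field mpoly set)"
  using p eliminate_closed[OF p]
  by (auto simp: mem_mono_ideal_iff keys_eliminate eliminate_gens_dvd expo_dvd_single)

text \<open>By \<open>regular_map\<close> a regular sequence is sent to one of the same length. It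
  stays in the maximal ideal because \<open>eliminate\<close> does not change the constant
  term.\<close>

lemma depth_quot_eliminate_le:
  "depth_quot (Suc n) (mono_ideal (Suc n) (insert (Poly_Mapping.single i 1) A) :: 'k::field mpoly set)
    \<le> depth_quot n (mono_ideal n (eliminate_gens i n A) :: 'k mpoly set)"
  unfolding depth_quot_alt[OF ideal_mono_ideal]
proof (rule SUP_least)
  let ?J = "mono_ideal (Suc n) (insert (Poly_Mapping.single i 1) A) :: 'k mpoly set"
  let ?I = "mono_ideal n (eliminate_gens i n A) :: 'k mpoly set"
  fix fs :: "'k mpoly list"
  assume fs: "fs \<in> {fs. set fs \<subseteq> max_ideal (Suc n) \<and> regular {..<Suc n} ?J fs}"
  then have c: "set fs \<subseteq> carrier (poly_ring (Suc n))" using max_ideal_subset by auto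
  have "regular {..<n} ?I (map (eliminate i n) fs)"
    by (rule regular_map[OF eliminate_add eliminate_mult eliminate_surj ideal_mono_ideal ideal_mono_ideal
          eliminate_mem_iff c]) (use fs in auto)
  moreover have "eliminate i n f \<in> max_ideal n" if "f \<in> max_ideal (Suc n)" for f :: "'k mpoly"
  proof -
    have "f \<in> carrier (poly_ring (Suc n))" "lookup f 0 = 0"
      using that max_ideal_subset by (auto simp: max_ideal_eq in_keys_iff)
    moreover have "swap_vars i n 0 = 0" by (rule poly_mapping_eqI) simp
    ultimately show ?thesis
      using eliminate_closed[of f] by (simp add: max_ideal_eq carrier_poly_ring in_keys_iff lookup_eliminate)
  qed
  ultimately show "enat (length fs) \<le>
      (SUP fs \<in> {fs. set fs \<subseteq> max_ideal n \<and> regular {..<n} ?I fs}. enat (length fs))"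
    using fs by (intro SUP_upper2[of "map (eliminate i n) fs"]) auto
qed

end


section \<open>Linear quotients\<close>

lemma keys_times_monomial: "keys (p * monomial u) = (\<lambda>m. m + u) ` keys p"
  for p :: "'k::field mpoly"
proof
  show "keys (p * monomial u) \<subseteq> (\<lambda>m. m + u) ` keys p"
    using keys_mult[of p "monomial u"] by auto
  have "p * monomial u = (\<Sum>m\<in>keys p. Poly_Mapping.single m (lookup p m)) * monomial u"
    by (simp flip: poly_mapping_sum_single)
  also have "\<dots> = (\<Sum>m\<in>keys p. Poly_Mapping.single (m + u) (lookup p m))"
    by (simp add: sum_distrib_right monomial_def mult_single)
  finally have "lookup (p * monomial u) (m + u) = lookup p m" for m
    by (simp add: lookup_sum lookup_single when_def in_keys_iff)
  then show "(\<lambda>m. m + u) ` keys p \<subseteq> keys (p * monomial u)"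
    by (auto simp: in_keys_iff)
qed

text \<open>Multiplication by a monomial shifts the support without cancellation, so both ideals are
  determined by the monomials they contain. Linear quotients thus become a condition on
  divisibility.\<close>

lemma colon_eq_vars_iff:
  assumes A: "A \<subseteq> expos n" and u: "u \<in> expos n" and V: "V \<subseteq> {..<n}"
  shows "colon n (Idl\<^bsub>poly_ring n\<^esub> (monomial ` A)) (monomial u) = (Idl\<^bsub>poly_ring n\<^esub> (var ` V) :: 'k::field mpoly set) \<longleftrightarrow>
    (\<forall>m\<in>expos n. (\<exists>a\<in>A. expo_dvd a (m + u)) \<longleftrightarrow> (\<exists>k\<in>V. 0 < lookup m k))" (is "?L = ?R \<longleftrightarrow> ?C")
proof -
  have L: "p \<in> ?L \<longleftrightarrow> p \<in> carrier (poly_ring n) \<and> (\<forall>m\<in>keys p. \<exists>a\<in>A. expo_dvd a (m + u))" for p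
    unfolding colon_def Idl_monomials[OF A] mono_ideal_def carrier_poly_ring
    by (auto simp: keys_times_monomial expos_add u)
  have R: "p \<in> ?R \<longleftrightarrow> p \<in> carrier (poly_ring n) \<and> (\<forall>m\<in>keys p. \<exists>k\<in>V. 0 < lookup m k)" for p
    by (simp add: Idl_vars[OF V] mem_mono_ideal_iff expo_dvd_single)
  show ?thesis
  proof
    assume eq: "?L = ?R"
    show ?C
    proof
      fix m assume "m \<in> expos n"
      then have "(monomial m :: 'k mpoly) \<in> carrier (poly_ring n)" by (simp add: carrier_poly_ring)
      then show "(\<exists>a\<in>A. expo_dvd a (m + u)) \<longleftrightarrow> (\<exists>k\<in>V. 0 < lookup m k)"
        using L[of "monomial m"] R[of "monomial m"] eq by simp
    qed
  next
    assume C: ?C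
    show "?L = ?R"
    proof (rule Set.set_eqI)
      fix p
      show "p \<in> ?L \<longleftrightarrow> p \<in> ?R"
        unfolding L R carrier_poly_ring using C by (auto simp: subset_iff)
    qed
  qed
qed

lemma min_gens_subset: "min_gens n I \<subseteq> expos n"
  by (auto simp: min_gens_def)

text \<open>A is an arbitrary generating set, so its renamed part need not be minimal. Divisors of a
  monomial without \<open>x\<^sub>i\<close> lack \<open>x\<^sub>i\<close> as well, so minimality is
  tested against corresponding monomials on both sides.\<close>

lemma min_gens_eliminate:
  fixes A :: "expo set"
  assumes i: "i \<le> n"
  shows "min_gens n (mono_ideal n (eliminate_gens i n A) :: 'k::field mpoly set) =
    eliminate_gens i n (min_gens (Suc n) (mono_ideal (Suc n) A :: 'k mpoly set))" (is "?L = eliminate_gens i n ?R")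
proof -
  have mem: "monomial (swap_vars i n m) \<in> (mono_ideal n (eliminate_gens i n A) :: 'k mpoly set) \<longleftrightarrow>
    monomial m \<in> (mono_ideal (Suc n) A :: 'k mpoly set)" if "m \<in> expos (Suc n)" "lookup m i = 0" for m
    using that expos_swap_vars(3)[OF i that] eliminate_gens_dvd[OF that(2)]
    by (simp add: monomial_mem_mono_ideal)
  have R: "swap_vars i n u \<in> ?L \<longleftrightarrow> u \<in> ?R" if u: "u \<in> expos (Suc n)" "lookup u i = 0" for u
  proof -
    have "(\<forall>v\<in>expos n. monomial v \<in> (mono_ideal n (eliminate_gens i n A) :: 'k mpoly set) \<longrightarrow>
        expo_dvd v (swap_vars i n u) \<longrightarrow> v = swap_vars i n u) \<longleftrightarrow>
      (\<forall>v\<in>expos (Suc n). monomial v \<in> (mono_ideal (Suc n) A :: 'k mpoly set) \<longrightarrow> expo_dvd v u \<longrightarrow> v = u)"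
      (is "?l \<longleftrightarrow> ?r")
    proof
      assume l: ?l
      show ?r
      proof (intro ballI impI)
        fix v assume v: "v \<in> expos (Suc n)" "monomial v \<in> (mono_ideal (Suc n) A :: 'k mpoly set)" "expo_dvd v u"
        then have "lookup v i = 0" using u(2) by (metis expo_dvd_def le_zero_eq)
        then have "swap_vars i n v = swap_vars i n u"
          using l v mem[of v] expos_swap_vars(3)[OF i, of v] by (simp add: expo_dvd_swap_vars)
        then show "v = u" using inj_swap_vars by (auto dest: injD)
      qed
    next
      assume r: ?r
      show ?l
      proof (intro ballI impI)
        fix v assume v: "v \<in> expos n" "monomial v \<in> (mono_ideal n (eliminate_gens i n A) :: 'k mpoly set)"
          "expo_dvd v (swap_vars i n u)"
        then have "swap_vars i n v \<in> expos (Suc n)" "lookup (swap_vars i n v) i = 0"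
          using expos_swap_vars[OF i] by auto
        with v r have "swap_vars i n v = u"
          using mem[of "swap_vars i n v"] by (simp add: expo_dvd_swap_vars)
        then show "v = swap_vars i n u" by auto
      qed
    qed
    then show ?thesis using mem[OF u] expos_swap_vars(3)[OF i u] u(1) by (simp add: min_gens_def)
  qed
  show ?thesis
  proof
    show "?L \<subseteq> eliminate_gens i n ?R"
    proof
      fix u assume u: "u \<in> ?L"
      then have "u \<in> expos n" using min_gens_subset by blast
      then have "swap_vars i n u \<in> expos (Suc n)" "lookup (swap_vars i n u) i = 0"
        using expos_swap_vars[OF i] by auto
      then show "u \<in> eliminate_gens i n ?R"
        unfolding eliminate_gens_def using R[of "swap_vars i n u"] u
        by (intro image_eqI[of _ _ "swap_vars i n u"]) auto
    qed
    show "eliminate_gens i n ?R \<subseteq> ?L"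
      using R min_gens_subset by (fastforce simp: eliminate_gens_def)
  qed
qed

text \<open>Lets the colon condition of the j-th retained generator be taken from its position l in
  the original order, which exceeds j when predecessors were discarded.\<close>

lemma filter_nth_take:
  "j < length (filter P us) \<Longrightarrow>
    \<exists>l<length us. us ! l = filter P us ! j \<and> filter P (take l us) = take j (filter P us)"
proof (induction us arbitrary: j)
  case (Cons u us)
  show ?case
  proof (cases "P u \<and> j = 0")
    case False
    define j' where "j' = (if P u then j - 1 else j)"
    have "j' < length (filter P us)" using Cons.prems False by (auto simp: j'_def split: if_splits)
    then obtain l where "l < length us" "us ! l = filter P us ! j'" "filter P (take l us) = take j' (filter P us)"
      using Cons.IH by blast
    then show ?thesis using False
      by (intro exI[of _ "Suc l"]) (auto simp: j'_def nth_Cons' take_Cons')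
  qed auto
qed simp

text \<open>For a retained generator u and a monomial m without \<open>x\<^sub>i\<close>, the
  product m u is divisible by an earlier generator exactly when it is divisible by an earlier
  retained one. Up to renaming, the old and new colon ideals therefore share their monomials without
  \<open>x\<^sub>i\<close>.\<close>

lemma linear_quotients_eliminate:
  fixes A :: "expo set"
  assumes i: "i \<le> n" and lq: "linear_quotients (Suc n) (mono_ideal (Suc n) A :: 'k::field mpoly set)"
  shows "linear_quotients n (mono_ideal n (eliminate_gens i n A) :: 'k mpoly set)"
proof -
  let ?I = "mono_ideal (Suc n) A :: 'k mpoly set"
  let ?P = "\<lambda>u :: expo. lookup u i = 0"
  obtain us where us: "distinct us" "set us = min_gens (Suc n) ?I"
    "\<And>j. 1 \<le> j \<Longrightarrow> j < length us \<Longrightarrow>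
         (\<exists>V \<subseteq> {..<Suc n}. colon (Suc n) (Idl\<^bsub>poly_ring (Suc n)\<^esub> (monomial ` set (take j us))) (monomial (us ! j))
            = (Idl\<^bsub>poly_ring (Suc n)\<^esub> (var ` V) :: 'k mpoly set))"
    using lq unfolding linear_quotients_def by blast
  have exp: "set us \<subseteq> expos (Suc n)" using us(2) min_gens_subset by simp
  let ?vs = "map (swap_vars i n) (filter ?P us)"
  have "\<exists>V \<subseteq> {..<n}. colon n (Idl\<^bsub>poly_ring n\<^esub> (monomial ` set (take j ?vs))) (monomial (?vs ! j))
            = (Idl\<^bsub>poly_ring n\<^esub> (var ` V) :: 'k mpoly set)" if j: "1 \<le> j" "j < length ?vs" for j
  proof -
    obtain l where l: "l < length us" "us ! l = filter ?P us ! j" "filter ?P (take l us) = take j (filter ?P us)"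
      using filter_nth_take[of j ?P us] j by auto
    define u where "u = us ! l"
    have vj: "?vs ! j = swap_vars i n u" using j l(2) by (simp add: u_def)
    have "u \<in> set (filter ?P us)" using l(2) j nth_mem[of j "filter ?P us"] by (simp add: u_def)
    then have u: "u \<in> expos (Suc n)" "lookup u i = 0" using exp by auto
    have tk: "set (take j ?vs) = eliminate_gens i n (set (take l us))"
      by (auto simp: take_map eliminate_gens_def simp flip: l(3))
    have texp: "set (take l us) \<subseteq> expos (Suc n)" using exp set_take_subset[of l us] by blast
    \<comment> \<open>The assumption covers only positions l \<ge> 1. Position 0 has no
      predecessors, whereas j \<ge> 1 retained generators precede u.\<close>
    have "l \<noteq> 0"
    proof
      assume "l = 0"
      then show False using arg_cong[OF l(3), of length] j by simp
    qed
    then obtain V where V: "V \<subseteq> {..<Suc n}"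
      "\<forall>m\<in>expos (Suc n). (\<exists>a\<in>set (take l us). expo_dvd a (m + u)) \<longleftrightarrow> (\<exists>k\<in>V. 0 < lookup m k)"
      using us(3)[of l] l(1) colon_eq_vars_iff[OF texp u(1)] unfolding u_def
      by (metis One_nat_def Suc_leI neq0_conv)
    \<comment> \<open>The variables of V under their new names; \<open>x\<^sub>i\<close> drops out,
      since only k = n is sent to i.\<close>
    let ?W = "{k. k < n \<and> transpose i n k \<in> V}"
    have "(\<exists>a\<in>set (take j ?vs). expo_dvd a (m + swap_vars i n u)) \<longleftrightarrow> (\<exists>k\<in>?W. 0 < lookup m k)"
      if m: "m \<in> expos n" for m
    proof -
      let ?m = "swap_vars i n m"
      have sm: "?m \<in> expos (Suc n)" "lookup ?m i = 0" using expos_swap_vars[OF i] m by auto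
      have "(\<exists>a\<in>set (take j ?vs). expo_dvd a (m + swap_vars i n u)) \<longleftrightarrow>
          (\<exists>a\<in>set (take l us). expo_dvd a (?m + u))"
        unfolding tk using eliminate_gens_dvd[of "?m + u" i n] sm(2) u(2) by (simp add: lookup_add swap_vars_add)
      also have "\<dots> \<longleftrightarrow> (\<exists>k\<in>V. 0 < lookup m (transpose i n k))"
        using V(2) sm(1) by simp
      also have "\<dots> \<longleftrightarrow> (\<exists>k\<in>?W. 0 < lookup m k)"
      proof
        assume "\<exists>k\<in>V. 0 < lookup m (transpose i n k)"
        then obtain k where k: "k \<in> V" "0 < lookup m (transpose i n k)" by blast
        then have "transpose i n k \<in> keys m" by (simp add: in_keys_iff)
        then have "transpose i n k < n" using m by (auto simp: expos_def)
        then show "\<exists>k\<in>?W. 0 < lookup m k" using k by (intro bexI[of _ "transpose i n k"]) auto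
      next
        assume "\<exists>k\<in>?W. 0 < lookup m k"
        then obtain k where "transpose i n k \<in> V" "0 < lookup m k" by blast
        then show "\<exists>k\<in>V. 0 < lookup m (transpose i n k)"
          by (intro bexI[of _ "transpose i n k"]) auto
      qed
      finally show ?thesis .
    qed
    moreover have "set (take j ?vs) \<subseteq> expos n"
      unfolding tk by (rule eliminate_gens_expos[OF i texp])
    ultimately have "colon n (Idl\<^bsub>poly_ring n\<^esub> (monomial ` set (take j ?vs))) (monomial (?vs ! j))
            = (Idl\<^bsub>poly_ring n\<^esub> (var ` ?W) :: 'k mpoly set)"
      unfolding vj using expos_swap_vars(3)[OF i u]
      by (subst colon_eq_vars_iff) auto
    then show ?thesis by (intro exI[of _ ?W]) auto
  qed
  moreover have "distinct ?vs"
    using us(1) inj_swap_vars by (auto simp: distinct_map inj_on_def)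
  moreover have "set ?vs = min_gens n (mono_ideal n (eliminate_gens i n A) :: 'k mpoly set)"
    unfolding min_gens_eliminate[OF i] us(2)[symmetric] by (auto simp: eliminate_gens_def)
  ultimately show ?thesis unfolding linear_quotients_def by blast
qed


section \<open>Stanley depth\<close>

lemma finsum_additive:
  assumes "abelian_group M" "abelian_group N" "finite A" "w \<in> A \<rightarrow> carrier M"
    and closed: "\<And>x. x \<in> carrier M \<Longrightarrow> h x \<in> carrier N"
    and zero: "h \<zero>\<^bsub>M\<^esub> = \<zero>\<^bsub>N\<^esub>"
    and add: "\<And>x y. x \<in> carrier M \<Longrightarrow> y \<in> carrier M \<Longrightarrow> h (x \<oplus>\<^bsub>M\<^esub> y) = h x \<oplus>\<^bsub>N\<^esub> h y"
  shows "h (finsum M w A) = finsum N (\<lambda>a. h (w a)) A"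
proof -
  interpret M: abelian_group M by fact
  interpret N: abelian_group N by fact
  show ?thesis using assms(3,4)
    by (induction A rule: finite_induct) (auto simp: Pi_def closed zero add)
qed

text \<open>M and N live over polynomial rings in different numbers of variables, so h is only
  semilinear, along a map g that takes K[Z] onto K[t Z]. Stanley spaces are then carried to Stanley
  spaces, and existence and uniqueness of sums follow from bijectivity of h.\<close>

lemma stanley_decomposition_map:
  fixes M :: "('k::field mpoly, 'm) module" and N :: "('k mpoly, 'l) module"
  assumes M: "abelian_group M" and N: "abelian_group N"
    and bij: "bij_betw h (carrier M) (carrier N)"
    and zero: "h \<zero>\<^bsub>M\<^esub> = \<zero>\<^bsub>N\<^esub>"
    and add: "\<And>x y. x \<in> carrier M \<Longrightarrow> y \<in> carrier M \<Longrightarrow> h (x \<oplus>\<^bsub>M\<^esub> y) = h x \<oplus>\<^bsub>N\<^esub> h y"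
    and smult: "\<And>p x. p \<in> carrier (poly_ring n) \<Longrightarrow> x \<in> carrier M \<Longrightarrow>
      p \<odot>\<^bsub>M\<^esub> x \<in> carrier M \<and> h (p \<odot>\<^bsub>M\<^esub> x) = g p \<odot>\<^bsub>N\<^esub> h x"
    and ring: "\<And>Z. Z \<subseteq> {..<n} \<Longrightarrow> g ` carrier (poly_ring_on Z) = carrier (poly_ring_on (t ` Z))"
    and g0: "g 0 = 0"
    and t: "t ` {..<n} \<subseteq> {..<k}"
    and graded: "\<And>x a. x \<in> gr a \<Longrightarrow> \<exists>b. h x \<in> gr' b"
    and D: "stanley_decomposition n M gr D"
  shows "stanley_decomposition k N gr' (map (\<lambda>(x, Z). (h x, t ` Z)) D)" (is "stanley_decomposition k N gr' ?D")
proof -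
  have DM: "x \<in> carrier M" "\<exists>a. x \<in> gr a" "Z \<subseteq> {..<n}"
      "\<And>p. p \<in> carrier (poly_ring_on Z) \<Longrightarrow> p \<odot>\<^bsub>M\<^esub> x = \<zero>\<^bsub>M\<^esub> \<Longrightarrow> p = 0"
    if "(x, Z) \<in> set D" for x Z
    using bspec[OF conjunct1[OF D[unfolded stanley_decomposition_def]] that] by auto
  have Dw: "\<exists>!w. w \<in> (\<Pi>\<^sub>E j\<in>{..<length D}. stanley_space M (D ! j)) \<and> v = (\<Oplus>\<^bsub>M\<^esub> j\<in>{..<length D}. w j)"
    if "v \<in> carrier M" for v
    by (rule bspec[OF conjunct2[OF D[unfolded stanley_decomposition_def]] that])
  have M0: "\<zero>\<^bsub>M\<^esub> \<in> carrier M"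
    using M by (simp add: abelian_group_def abelian_monoid.zero_closed)
  have inj: "x = y" if "x \<in> carrier M" "y \<in> carrier M" "h x = h y" for x y
    using bij that by (auto simp: bij_betw_def inj_on_def)
  have hc: "h x \<in> carrier N" if "x \<in> carrier M" for x using bij that by (auto simp: bij_betw_def)
  have sub: "p \<in> carrier (poly_ring n)" if "p \<in> carrier (poly_ring_on Z)" "Z \<subseteq> {..<n}" for p :: "'k mpoly" and Z
    using that by (auto simp: poly_ring_on_simps(1))
  have spaceM: "stanley_space M (D ! j) \<subseteq> carrier M" if "j < length D" for j
  proof -
    obtain x Z where xZ: "D ! j = (x, Z)" by fastforce
    then have "(x, Z) \<in> set D" using that nth_mem by metis
    then have "p \<odot>\<^bsub>M\<^esub> x \<in> carrier M" if "p \<in> carrier (poly_ring_on Z)" for p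
      using smult[OF sub[OF that DM(3)] DM(1)] by blast
    then show ?thesis by (auto simp: stanley_space_def xZ)
  qed
  have space: "stanley_space N (?D ! j) = h ` stanley_space M (D ! j)" if "j < length D" for j
  proof -
    obtain x Z where xZ: "D ! j = (x, Z)" by fastforce
    then have xD: "(x, Z) \<in> set D" using that nth_mem by metis
    have "stanley_space N (?D ! j) = (\<lambda>p. p \<odot>\<^bsub>N\<^esub> h x) ` g ` carrier (poly_ring_on Z)"
      using that by (simp add: xZ stanley_space_def ring[OF DM(3)[OF xD]] setcompr_eq_image)
    also have "\<dots> = (\<lambda>p. h (p \<odot>\<^bsub>M\<^esub> x)) ` carrier (poly_ring_on Z)"
      unfolding image_image using smult[OF sub[OF _ DM(3)[OF xD]] DM(1)[OF xD]]
      by (intro image_cong[OF refl]) simp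
    also have "\<dots> = h ` stanley_space M (D ! j)"
      by (simp add: xZ stanley_space_def setcompr_eq_image image_image)
    finally show ?thesis .
  qed
  have hsum: "h (\<Oplus>\<^bsub>M\<^esub> j\<in>{..<length D}. w j) = (\<Oplus>\<^bsub>N\<^esub> j\<in>{..<length D}. h (w j))"
    and sumM: "(\<Oplus>\<^bsub>M\<^esub> j\<in>{..<length D}. w j) \<in> carrier M"
    if "w \<in> (\<Pi>\<^sub>E j\<in>{..<length D}. stanley_space M (D ! j))" for w
  proof -
    have w: "w \<in> {..<length D} \<rightarrow> carrier M" using that spaceM by fastforce
    show "h (\<Oplus>\<^bsub>M\<^esub> j\<in>{..<length D}. w j) = (\<Oplus>\<^bsub>N\<^esub> j\<in>{..<length D}. h (w j))"
      by (rule finsum_additive[OF M N _ w]) (auto simp: zero add hc)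
    interpret M: abelian_group M by (rule M)
    show "(\<Oplus>\<^bsub>M\<^esub> j\<in>{..<length D}. w j) \<in> carrier M" using w by (rule M.finsum_closed)
  qed
  have restr: "(\<Oplus>\<^bsub>N\<^esub> j\<in>{..<length D}. (\<lambda>j\<in>{..<length D}. h (w j)) j) = (\<Oplus>\<^bsub>N\<^esub> j\<in>{..<length D}. h (w j))"
    if "w \<in> (\<Pi>\<^sub>E j\<in>{..<length D}. stanley_space M (D ! j))" for w
  proof -
    interpret N: abelian_group N by (rule N)
    show ?thesis using that spaceM hc by (intro N.finsum_cong') fastforce+
  qed
  \<comment> \<open>For uniqueness: a competing family over N is pulled back to M, where uniqueness
    is known. \<open>restrict\<close> keeps the pulled-back family in the extensional function
    space.\<close>
  have lift: "\<exists>w'. w' \<in> (\<Pi>\<^sub>E j\<in>{..<length D}. stanley_space M (D ! j)) \<and> w = (\<lambda>j\<in>{..<length D}. h (w' j))"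
    if w: "w \<in> (\<Pi>\<^sub>E j\<in>{..<length D}. stanley_space N (?D ! j))" for w
  proof -
    have "\<forall>j\<in>{..<length D}. \<exists>x. x \<in> stanley_space M (D ! j) \<and> w j = h x"
    proof
      fix j assume j: "j \<in> {..<length D}"
      have "w j \<in> h ` stanley_space M (D ! j)"
        using PiE_mem[OF w j] space j by simp
      then show "\<exists>x. x \<in> stanley_space M (D ! j) \<and> w j = h x" by blast
    qed
    then obtain w' where w': "\<forall>j\<in>{..<length D}. w' j \<in> stanley_space M (D ! j) \<and> w j = h (w' j)"
      unfolding bchoice_iff by (rule exE)
    have "w = (\<lambda>j\<in>{..<length D}. h (restrict w' {..<length D} j))"
    proof
      fix j
      show "w j = (\<lambda>j\<in>{..<length D}. h (restrict w' {..<length D} j)) j"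
      proof (cases "j \<in> {..<length D}")
        case True
        then show ?thesis using w' by simp
      next
        case False
        then show ?thesis using PiE_arb[OF w] by simp
      qed
    qed
    then show ?thesis using w' by (intro exI[of _ "restrict w' {..<length D}"]) auto
  qed
  have Nw: "\<exists>!w. w \<in> (\<Pi>\<^sub>E j\<in>{..<length D}. stanley_space N (?D ! j)) \<and> v = (\<Oplus>\<^bsub>N\<^esub> j\<in>{..<length D}. w j)"
    if v: "v \<in> carrier N" for v
  proof -
    obtain u where u: "u \<in> carrier M" "v = h u" using v bij by (auto simp: bij_betw_def)
    obtain w where w: "w \<in> (\<Pi>\<^sub>E j\<in>{..<length D}. stanley_space M (D ! j))" "u = (\<Oplus>\<^bsub>M\<^esub> j\<in>{..<length D}. w j)"
      "\<And>w'. w' \<in> (\<Pi>\<^sub>E j\<in>{..<length D}. stanley_space M (D ! j)) \<Longrightarrow> u = (\<Oplus>\<^bsub>M\<^esub> j\<in>{..<length D}. w' j) \<Longrightarrow> w' = w"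
      using Dw[OF u(1)] by blast
    show ?thesis
    proof (rule ex1I[of _ "\<lambda>j\<in>{..<length D}. h (w j)"], intro conjI)
      show "(\<lambda>j\<in>{..<length D}. h (w j)) \<in> (\<Pi>\<^sub>E j\<in>{..<length D}. stanley_space N (?D ! j))"
        using w(1) space by (auto simp: PiE_iff)
      show "v = (\<Oplus>\<^bsub>N\<^esub> j\<in>{..<length D}. (\<lambda>j\<in>{..<length D}. h (w j)) j)"
        unfolding restr[OF w(1)] hsum[OF w(1), symmetric] w(2)[symmetric] by (rule u(2))
    next
      fix z assume z: "z \<in> (\<Pi>\<^sub>E j\<in>{..<length D}. stanley_space N (?D ! j)) \<and> v = (\<Oplus>\<^bsub>N\<^esub> j\<in>{..<length D}. z j)"
      then obtain w' where w': "w' \<in> (\<Pi>\<^sub>E j\<in>{..<length D}. stanley_space M (D ! j))"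
        "z = (\<lambda>j\<in>{..<length D}. h (w' j))" using lift by blast
      have "v = h (\<Oplus>\<^bsub>M\<^esub> j\<in>{..<length D}. w' j)"
        unfolding hsum[OF w'(1)] restr[OF w'(1), symmetric] w'(2)[symmetric] using z by blast
      then have "u = (\<Oplus>\<^bsub>M\<^esub> j\<in>{..<length D}. w' j)"
        using inj[OF u(1) sumM[OF w'(1)]] u(2) by simp
      then show "z = (\<lambda>j\<in>{..<length D}. h (w j))" using w(3)[OF w'(1)] w'(2) by simp
    qed
  qed
  have DN: "h x \<in> carrier N \<and> (\<exists>b. h x \<in> gr' b) \<and> t ` Z \<subseteq> {..<k} \<and>
      (\<forall>p\<in>carrier (poly_ring_on (t ` Z)). p \<odot>\<^bsub>N\<^esub> h x = \<zero>\<^bsub>N\<^esub> \<longrightarrow> p = 0)" if xD: "(x, Z) \<in> set D" for x Z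
  proof (intro conjI ballI impI)
    fix p assume p: "p \<in> carrier (poly_ring_on (t ` Z))" "p \<odot>\<^bsub>N\<^esub> h x = \<zero>\<^bsub>N\<^esub>"
    obtain q where q: "q \<in> carrier (poly_ring_on Z)" "p = g q"
      using p(1) unfolding ring[OF DM(3)[OF xD], symmetric] by (rule imageE)
    note sm = smult[OF sub[OF q(1) DM(3)[OF xD]] DM(1)[OF xD]]
    have "h (q \<odot>\<^bsub>M\<^esub> x) = h \<zero>\<^bsub>M\<^esub>" using sm p(2) q(2) zero by simp
    then have "q \<odot>\<^bsub>M\<^esub> x = \<zero>\<^bsub>M\<^esub>" using inj sm M0 by blast
    then show "p = 0" using DM(4)[OF xD q(1)] q(2) g0 by simp
  next
    show "h x \<in> carrier N" by (rule hc[OF DM(1)[OF xD]])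
    show "\<exists>b. h x \<in> gr' b" using DM(2)[OF xD] graded by blast
    show "t ` Z \<subseteq> {..<k}" using DM(3)[OF xD] t by blast
  qed
  show ?thesis
    unfolding stanley_decomposition_def length_map
  proof (intro conjI ballI)
    fix y assume "y \<in> set ?D"
    then obtain x Z where y: "y = (h x, t ` Z)" "(x, Z) \<in> set D" by auto
    show "case y of (m, Z) \<Rightarrow> m \<in> carrier N \<and> (\<exists>a. m \<in> gr' a) \<and> Z \<subseteq> {..<k} \<and>
        (\<forall>p\<in>carrier (poly_ring_on Z). p \<odot>\<^bsub>N\<^esub> m = \<zero>\<^bsub>N\<^esub> \<longrightarrow> p = 0)"
      unfolding y(1) case_prod_conv by (rule DN[OF y(2)])
  qed (rule Nw)
qed

lemma sdepth_decomp_map: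
  assumes "inj t"
  shows "sdepth_decomp (map (\<lambda>(x, Z). (h x, t ` Z)) D) = sdepth_decomp D"
proof -
  have "card (t ` Z) = card Z" for Z using assms by (intro card_image inj_on_subset[OF assms]) auto
  then show ?thesis by (simp add: sdepth_decomp_def image_image case_prod_beta)
qed

lemma sdepth_quot_eliminate_ge:
  assumes i: "i \<le> n"
  shows "sdepth_quot n (mono_ideal n (eliminate_gens i n A) :: 'k::field mpoly set)
    \<le> sdepth_quot (Suc n) (mono_ideal (Suc n) (insert (Poly_Mapping.single i 1) A) :: 'k mpoly set)"
proof -
  let ?I = "mono_ideal n (eliminate_gens i n A) :: 'k mpoly set"
  define J :: "'k mpoly set" where "J = mono_ideal (Suc n) (insert (Poly_Mapping.single i 1) A)"
  let ?M = "quot_module (poly_ring n) ?I" and ?N = "quot_module (poly_ring (Suc n)) J"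
  note I = ideal_mono_ideal[of n "eliminate_gens i n A", where 'k='k]
  have J: "ideal J (poly_ring (Suc n))" unfolding J_def by (rule ideal_mono_ideal)
  have mem: "p \<in> J \<longleftrightarrow> eliminate i n p \<in> ?I" if "p \<in> carrier (poly_ring (Suc n))" for p
    unfolding J_def by (rule eliminate_mem_iff[OF i that])
  \<comment> \<open>The isomorphism from S'/I' to \<open>S/(I, x\<^sub>i)\<close>, taking a coset to
    its full preimage under \<open>eliminate\<close>. No representative is chosen, so
    well-definedness is automatic.\<close>
  define h where "h X = {q \<in> carrier (poly_ring (Suc n)). eliminate i n q \<in> X}" for X :: "'k mpoly set"
  note rc = relabel_closed[OF i]
  have h: "h (coset {..<n} ?I p) = coset {..<Suc n} J (relabel i n p)"
    if p: "p \<in> carrier (poly_ring n)" for p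
  proof (rule Set.set_eqI)
    fix q
    have *: "q - relabel i n p \<in> J \<longleftrightarrow> eliminate i n q - p \<in> ?I" if "q \<in> carrier (poly_ring (Suc n))"
      using mem[OF poly_ring_closed(4)[OF that rc[OF p]]]
      by (simp add: eliminate_diff eliminate_relabel[OF i p])
    have "q \<in> carrier (poly_ring (Suc n))" if "q - relabel i n p \<in> J"
      using poly_ring_closed(1)[OF ideal_closed(2)[OF J that] rc[OF p]] by simp
    with * show "q \<in> h (coset {..<n} ?I p) \<longleftrightarrow> q \<in> coset {..<Suc n} J (relabel i n p)"
      unfolding h_def mem_coset_iff[OF J] mem_Collect_eq mem_coset_iff[OF I] by blast
  qed
  have "inj_on h (carrier ?M)"
  proof (rule inj_onI)
    fix X Y assume XY: "X \<in> carrier ?M" "Y \<in> carrier ?M" "h X = h Y"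
    then obtain p q where pq: "p \<in> carrier (poly_ring n)" "q \<in> carrier (poly_ring n)"
      "X = coset {..<n} ?I p" "Y = coset {..<n} ?I q" unfolding carrier_quot_module[OF I] by blast
    have "relabel i n (p - q) \<in> J"
      using XY(3) unfolding pq(3,4) h[OF pq(1)] h[OF pq(2)] coset_eq_iff[OF J] relabel_diff .
    then have "p - q \<in> ?I"
      using mem[OF rc[OF poly_ring_closed(4)[OF pq(1,2)]]]
        eliminate_relabel[OF i poly_ring_closed(4)[OF pq(1,2)]] by simp
    then show "X = Y" by (simp add: pq coset_eq_iff[OF I])
  qed
  moreover have "h ` carrier ?M = carrier ?N"
  proof
    show "h ` carrier ?M \<subseteq> carrier ?N"
      unfolding carrier_quot_module[OF I] carrier_quot_module[OF J] using h rc by auto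
    show "carrier ?N \<subseteq> h ` carrier ?M"
    proof
      fix X assume "X \<in> carrier ?N"
      then obtain p where p: "p \<in> carrier (poly_ring (Suc n))" "X = coset {..<Suc n} J p"
        unfolding carrier_quot_module[OF J] by blast
      note e = eliminate_closed[OF i p(1)]
      \<comment> \<open>Surjectivity: p and the renamed copy of its part without
        \<open>x\<^sub>i\<close> have the same image in S', so they differ by an element of
        J.\<close>
      have "eliminate i n (p - relabel i n (eliminate i n p)) = 0"
        by (simp add: eliminate_diff eliminate_relabel[OF i e])
      then have "p - relabel i n (eliminate i n p) \<in> J"
        using mem[OF poly_ring_closed(4)[OF p(1) rc[OF e]]] ideal_closed(1)[OF I] by simp
      then have "X = h (coset {..<n} ?I (eliminate i n p))"
        unfolding p(2) h[OF e] coset_eq_iff[OF J] .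
      then show "X \<in> h ` carrier ?M" unfolding carrier_quot_module[OF I] using e by blast
    qed
  qed
  ultimately have bij: "bij_betw h (carrier ?M) (carrier ?N)" by (simp add: bij_betw_def)
  have r0: "relabel i n (0 :: 'k mpoly) = 0" by (rule poly_mapping_eqI) simp
  have zero: "h \<zero>\<^bsub>?M\<^esub> = \<zero>\<^bsub>?N\<^esub>"
    using h[of 0] r0 by (simp add: zero_quot_module[OF I] zero_quot_module[OF J])
  have add: "h (X \<oplus>\<^bsub>?M\<^esub> Y) = h X \<oplus>\<^bsub>?N\<^esub> h Y" if "X \<in> carrier ?M" "Y \<in> carrier ?M" for X Y
    using that unfolding carrier_quot_module[OF I]
    by (auto simp: add_quot_module[OF I] add_quot_module[OF J] h rc poly_ring_closed(1) relabel_add)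
  have smult: "p \<odot>\<^bsub>?M\<^esub> X \<in> carrier ?M \<and> h (p \<odot>\<^bsub>?M\<^esub> X) = relabel i n p \<odot>\<^bsub>?N\<^esub> h X"
    if "p \<in> carrier (poly_ring n)" "X \<in> carrier ?M" for p X
    using that unfolding carrier_quot_module[OF I]
    by (auto simp: smult_quot_module[OF I] smult_quot_module[OF J] h rc poly_ring_closed(2) relabel_mult)
  have graded: "\<exists>b. h X \<in> quot_grading (Suc n) J b" if X: "X \<in> quot_grading n ?I a" for X a
  proof -
    obtain p where p: "p \<in> poly_grading n a" "X = coset {..<n} ?I p"
      using X by (auto simp: quot_grading_def)
    then have pc: "p \<in> carrier (poly_ring n)" by (simp add: poly_grading_def)
    \<comment> \<open>Renaming permutes the coordinates of the degree.\<close>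
    have "relabel i n p \<in> poly_grading (Suc n) (a \<circ> transpose i n)"
      using p(1) rc[OF pc] by (auto simp: poly_grading_def keys_relabel)
    then show ?thesis unfolding p(2) h[OF pc] quot_grading_def by blast
  qed
  have t: "transpose i n ` {..<n} \<subseteq> {..<Suc n}" using i by (auto simp: transpose_def)
  show ?thesis
    unfolding J_def[symmetric] sdepth_quot_def sdepth_def
  proof (rule SUP_least)
    fix D assume "D \<in> {D. stanley_decomposition n ?M (quot_grading n ?I) D}"
    then have "stanley_decomposition (Suc n) ?N (quot_grading (Suc n) J) (map (\<lambda>(x, Z). (h x, transpose i n ` Z)) D)"
      by (intro stanley_decomposition_map[OF abelian_group_quot_module[OF I] abelian_group_quot_module[OF J]
            bij zero add smult relabel_poly_ring_on r0 t graded]) auto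
    then show "sdepth_decomp D \<le> (SUP D \<in> {D. stanley_decomposition (Suc n) ?N (quot_grading (Suc n) J) D}. sdepth_decomp D)"
      by (intro SUP_upper2[of "map (\<lambda>(x, Z). (h x, transpose i n ` Z)) D"])
         (simp_all add: sdepth_decomp_map)
  qed
qed

section \<open>The zero ideal\<close>

lemma ideal_zero: "ideal {0} (poly_ring n :: 'k::field mpoly ring)"
  by (rule idealI_poly_ring_on) auto

lemma sdepth_quot_zero_ge: "enat n \<le> sdepth_quot n ({0} :: 'k::field mpoly set)"
proof -
  note I = ideal_zero[of n, where 'k='k]
  let ?M = "quot_module (poly_ring n) ({0} :: 'k mpoly set)"
  let ?D = "[(coset {..<n} {0} (1 :: 'k mpoly), {..<n})]"
  interpret M: abelian_group ?M by (rule abelian_group_quot_module[OF I])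
  have smult: "p \<odot>\<^bsub>?M\<^esub> coset {..<n} {0} 1 = coset {..<n} {0} p" if "p \<in> carrier (poly_ring n)" for p
    using smult_quot_module[OF I that, of 1] by simp
  have space: "stanley_space ?M (?D ! j) = carrier ?M" if "j < length ?D" for j
    using that smult by (fastforce simp: stanley_space_def carrier_quot_module[OF I])
  have sum: "(\<Oplus>\<^bsub>?M\<^esub> j\<in>{..<length ?D}. w j) = w 0" if "w 0 \<in> carrier ?M" for w
    using that by (simp add: lessThan_Suc)
  have "stanley_decomposition n ?M (quot_grading n {0}) ?D"
    unfolding stanley_decomposition_def
  proof (intro conjI ballI)
    have "1 \<in> poly_grading n (\<lambda>_. 0)" by (auto simp: poly_grading_def)
    then have "\<exists>a. coset {..<n} {0} 1 \<in> quot_grading n {0} a" unfolding quot_grading_def by blast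
    moreover have "p = 0" if "p \<in> carrier (poly_ring n)" "p \<odot>\<^bsub>?M\<^esub> coset {..<n} {0} 1 = \<zero>\<^bsub>?M\<^esub>" for p
      using that by (simp add: smult zero_quot_module[OF I] coset_eq_iff[OF I])
    ultimately show "case x of (m, Z) \<Rightarrow> m \<in> carrier ?M \<and> (\<exists>a. m \<in> quot_grading n {0} a) \<and> Z \<subseteq> {..<n} \<and>
        (\<forall>p\<in>carrier (poly_ring_on Z). p \<odot>\<^bsub>?M\<^esub> m = \<zero>\<^bsub>?M\<^esub> \<longrightarrow> p = 0)" if "x \<in> set ?D" for x
      using that by (auto simp: carrier_quot_module[OF I])
  next
    fix v assume v: "v \<in> carrier ?M"
    show "\<exists>!w. w \<in> (\<Pi>\<^sub>E j\<in>{..<length ?D}. stanley_space ?M (?D ! j)) \<and> v = (\<Oplus>\<^bsub>?M\<^esub> j\<in>{..<length ?D}. w j)"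
    proof (rule ex1I[of _ "\<lambda>j\<in>{..<length ?D}. v"], intro conjI)
      show "(\<lambda>j\<in>{..<length ?D}. v) \<in> (\<Pi>\<^sub>E j\<in>{..<length ?D}. stanley_space ?M (?D ! j))"
        using v space by auto
      show "v = (\<Oplus>\<^bsub>?M\<^esub> j\<in>{..<length ?D}. (\<lambda>j\<in>{..<length ?D}. v) j)"
        by (subst sum) (use v in auto)
    next
      fix w assume w: "w \<in> (\<Pi>\<^sub>E j\<in>{..<length ?D}. stanley_space ?M (?D ! j)) \<and> v = (\<Oplus>\<^bsub>?M\<^esub> j\<in>{..<length ?D}. w j)"
      then have "w 0 \<in> carrier ?M" using space[of 0] by (auto simp: PiE_iff)
      then have "v = w 0" using w sum by simp
      then show "w = (\<lambda>j\<in>{..<length ?D}. v)"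
        using w by (intro ext) (auto simp: PiE_iff extensional_def)
    qed
  qed
  then have "sdepth_decomp ?D \<le> sdepth_quot n ({0} :: 'k mpoly set)"
    unfolding sdepth_quot_def sdepth_def by (intro SUP_upper) simp
  then show ?thesis by (simp add: sdepth_decomp_def)
qed

text \<open>Only 1 divides 1. Properness becomes a condition on the generators, in which form it
  passes easily to \<open>eliminate_gens\<close>.\<close>

lemma mono_ideal_carrier_iff:
  assumes "A \<subseteq> expos n"
  shows "mono_ideal n A = (carrier (poly_ring n) :: 'k::field mpoly set) \<longleftrightarrow> 0 \<in> A"
proof
  assume eq: "mono_ideal n A = (carrier (poly_ring n) :: 'k mpoly set)"
  have "1 \<in> (mono_ideal n A :: 'k mpoly set)" unfolding eq by simp
  then obtain a where a: "a \<in> A" "expo_dvd a 0" by (auto simp: mono_ideal_def)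
  then have "a = 0" by (intro poly_mapping_eqI) (auto simp: expo_dvd_def)
  then show "0 \<in> A" using a by simp
next
  assume "0 \<in> A"
  moreover have "expo_dvd 0 m" for m by (simp add: expo_dvd_def)
  ultimately show "mono_ideal n A = (carrier (poly_ring n) :: 'k mpoly set)"
    unfolding mono_ideal_def set_eq_iff carrier_poly_ring mem_Collect_eq by blast
qed

theorem theorem2p12:
  assumes "\<forall>n\<ge>1. \<forall>I :: 'k::field mpoly set.
      monomial_ideal n I \<and> I \<noteq> {0} \<and> I \<noteq> carrier (poly_ring n) \<and> linear_quotients n I \<longrightarrow>
      (\<exists>i<n. depth_quot n (add_var n I i) \<ge> depth_quot n I \<and>
             sdepth_quot n (add_var n I i) \<le> sdepth_quot n I)"
  shows "\<forall>n\<ge>1. \<forall>I :: 'k mpoly set.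
      monomial_ideal n I \<and> I \<noteq> carrier (poly_ring n) \<and> linear_quotients n I \<longrightarrow>
      sdepth_quot n I \<ge> depth_quot n I"
proof -
  have zero: "depth_quot n {0} \<le> sdepth_quot n ({0} :: 'k mpoly set)" for n
    using depth_quot_le[OF ideal_zero] sdepth_quot_zero_ge by (rule order_trans)
  \<comment> \<open>The induction runs over generating sets, since these are what
    \<open>eliminate_gens\<close> transforms. It starts at n = 0, which is reached by eliminating
    the only variable.\<close>
  have mono: "depth_quot n (mono_ideal n A :: 'k mpoly set) \<le> sdepth_quot n (mono_ideal n A :: 'k mpoly set)"
    if "A \<subseteq> expos n" "0 \<notin> A" "linear_quotients n (mono_ideal n A :: 'k mpoly set)" for n A
    using that
  proof (induction n arbitrary: A)
    case 0
    \<comment> \<open>Without variables the only exponent vector is 0, so the base case is the zero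
      ideal.\<close>
    then have "A = {}" by (auto simp: expos_def)
    then have "mono_ideal 0 A = ({0} :: 'k mpoly set)" by (auto simp: mono_ideal_def)
    then show ?case using zero by simp
  next
    case (Suc n)
    let ?I = "mono_ideal (Suc n) A :: 'k mpoly set"
    show ?case
    proof (cases "?I = {0}")
      case True
      then show ?thesis using zero by simp
    next
      case False
      have "monomial_ideal (Suc n) ?I"
        unfolding monomial_ideal_def using Idl_monomials[OF Suc.prems(1)] Suc.prems(1) by metis
      moreover have "?I \<noteq> carrier (poly_ring (Suc n))"
        using mono_ideal_carrier_iff[OF Suc.prems(1), where 'k='k] Suc.prems(2) by simp
      ultimately obtain i where i: "i < Suc n" "depth_quot (Suc n) ?I \<le> depth_quot (Suc n) (add_var (Suc n) ?I i)"
        "sdepth_quot (Suc n) (add_var (Suc n) ?I i) \<le> sdepth_quot (Suc n) ?I"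
        using assms[rule_format, of "Suc n" ?I] False Suc.prems(3) by auto
      then have "i \<le> n" by simp
      have "0 \<notin> eliminate_gens i n A"
      proof
        assume "0 \<in> eliminate_gens i n A"
        then obtain a where a: "a \<in> A" "swap_vars i n a = 0" by (auto simp: eliminate_gens_def)
        then have "swap_vars i n 0 = a" by (metis swap_vars_involutory)
        moreover have "swap_vars i n 0 = 0" by (rule poly_mapping_eqI) simp
        ultimately show False using a(1) Suc.prems(2) by simp
      qed
      then have IH: "depth_quot n (mono_ideal n (eliminate_gens i n A) :: 'k mpoly set)
          \<le> sdepth_quot n (mono_ideal n (eliminate_gens i n A) :: 'k mpoly set)"
        using Suc.IH eliminate_gens_expos[OF \<open>i \<le> n\<close> Suc.prems(1)]
          linear_quotients_eliminate[OF \<open>i \<le> n\<close> Suc.prems(3)] by blast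
      note i(2)
      also have "depth_quot (Suc n) (add_var (Suc n) ?I i)
          \<le> depth_quot n (mono_ideal n (eliminate_gens i n A) :: 'k mpoly set)"
        unfolding mono_ideal_insert_var[OF Suc.prems(1) i(1)] by (rule depth_quot_eliminate_le[OF \<open>i \<le> n\<close>])
      also note IH
      also have "sdepth_quot n (mono_ideal n (eliminate_gens i n A) :: 'k mpoly set)
          \<le> sdepth_quot (Suc n) (add_var (Suc n) ?I i)"
        unfolding mono_ideal_insert_var[OF Suc.prems(1) i(1)] by (rule sdepth_quot_eliminate_ge[OF \<open>i \<le> n\<close>])
      also note i(3)
      finally show ?thesis .
    qed
  qed
  show ?thesis
  proof (intro allI impI)
    fix n and I :: "'k mpoly set"
    assume I: "monomial_ideal n I \<and> I \<noteq> carrier (poly_ring n) \<and> linear_quotients n I"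
    then obtain A where A: "A \<subseteq> expos n" "I = mono_ideal n A"
      unfolding monomial_ideal_def using Idl_monomials by metis
    then show "depth_quot n I \<le> sdepth_quot n I"
      using mono[OF A(1)] I mono_ideal_carrier_iff[OF A(1), where 'k='k] by simp
  qed
qed

end
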